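(* Let $P\subset\mathbb R^d$ be a rational $d$-polytope with $P=-P$. The following are equivalent: (1) $\mathrm{ehr}_{P+\bm v}$ is symmetric for every $\bm v\in\mathbb Q^d$; (2) $2P$ is an integral polytope (all vertices of $2P$ lie in $\mathbb Z^d$).
   Context: A quasi-polynomial is symmetric if its $k$th constituent equals its $(-k)$th constituent for all $k\in\mathbb Z$ (constituents indexed by residues modulo a period). $\mathrm{ehr}_X(t)=\#(tX\cap\mathbb Z^d)$ for $t\in\mathbb Z_{\ge0}$, extended to $\mathbb Z$ as a quasi-polynomial; $P+\bm v=\{\bm x+\bm v:\bm x\in P\}$. *)

theory Defs
  imports "HOL-Analysis.Analysis" "HOL-Computational_Algebra.Polynomial"
begin

definition lattice_points :: "(real^'n) set" where
  "lattice_points = {x. \<forall>i. x $ i \<in> \<int>}"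

definition rational_vec :: "real^'n \<Rightarrow> bool" where
  "rational_vec x \<longleftrightarrow> (\<forall>i. x $ i \<in> \<rat>)"

definition rational_polytope :: "(real^'n) set \<Rightarrow> bool" where
  "rational_polytope P \<longleftrightarrow> (\<exists>S. finite S \<and> (\<forall>x\<in>S. rational_vec x) \<and> P = convex hull S)"

definition ehr :: "(real^'n) set \<Rightarrow> nat \<Rightarrow> nat" where
  "ehr X t = card (((\<lambda>x. real t *\<^sub>R x) ` X) \<inter> lattice_points)"

text \<open>The Ehrhart function, extended to the integers as a quasi-polynomial with
  period N and constituents p 0, ..., p (N-1) (constituent k used on residue class k mod N),
  is symmetric: constituent k equals constituent (-k mod N).  Since the quasi-polynomial
  extension is unique and symmetry does not depend on the chosen period, an existential
  formulation is faithful.\<close>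
definition ehr_symmetric :: "(real^'n) set \<Rightarrow> bool" where
  "ehr_symmetric X \<longleftrightarrow>
     (\<exists>N::nat. N > 0 \<and> (\<exists>p :: nat \<Rightarrow> real poly.
        (\<forall>t::nat. real (ehr X t) = poly (p (t mod N)) (real t)) \<and>
        (\<forall>k<N. p k = p ((N - k) mod N))))"

end

theory Submission
  imports Defs
begin

text \<open>
  Everything rests on the Euler relation: if a linear combination of indicator functions of compact
  convex sets vanishes, then so does the sum of the coefficients over the nonempty sets. It follows by
  slicing from the case of intervals.

  Let \<open>Q\<close> be the convex hull of a finite set \<open>S\<close> of lattice points. Applied to polytopes of vertex
  weights, the Euler relation yields \<open>\<Prod>s\<in>S. ([Q] - [s]) = 0\<close> for the Minkowski product of indicator
  functions. As translations by \<open>s\<close> preserve lattice points, the \<open>card S\<close>-th difference of the number of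
  lattice points in \<open>(m + r) Q + c\<close> vanishes for all real \<open>r \<ge> 0\<close> and all \<open>c\<close>, so this number is a
  polynomial in \<open>m\<close>. If \<open>2P\<close> is integral, the number of lattice points in \<open>tP + c\<close> is thus a polynomial on
  each parity class of \<open>t\<close>; together with \<open>P = -P\<close> this gives the symmetry.

  Conversely, let \<open>D P\<close> be integral. Symmetry for every \<open>v\<close> says that the polynomials counting \<open>tP + v\<close>
  on \<open>t \<equiv> 1\<close> and on \<open>t \<equiv> -1\<close> modulo \<open>D\<close> coincide, so Lagrange extrapolation expresses the count of
  \<open>P + v\<close> through those of finitely many \<open>tP + v\<close> with \<open>t \<equiv> -1\<close>. Read as a function of \<open>v\<close>, this is a
  linear relation between indicator functions of the sets \<open>z + tP\<close> with \<open>z\<close> a lattice point. Near a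
  vertex \<open>w\<close> of \<open>P\<close>, the Euler relation isolates those sets whose vertex \<open>z + tw\<close> is \<open>w\<close>. The set \<open>P\<close> itself
  must be cancelled by some \<open>z + tP\<close> with \<open>t \<equiv> -1\<close>, and then \<open>2w = z + (t + 1)w\<close> is a lattice point.
\<close>

section \<open>The Euler relation\<close>

text \<open>Subtracting the relation just to the right of \<open>r\<close> from the relation at
  \<open>r\<close> leaves exactly the intervals that end at \<open>r\<close>, so their coefficients
  sum to zero; each nonempty set has exactly one right end.\<close>

lemma euler_relation_intervals:
  fixes C :: "'j \<Rightarrow> real set" and b :: "'j \<Rightarrow> real"
  assumes "finite J"
    and cpt: "\<And>j. j \<in> J \<Longrightarrow> compact (C j)"
    and cvx: "\<And>j. j \<in> J \<Longrightarrow> is_interval (C j)"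
    and rel: "\<And>x. (\<Sum>j\<in>{j\<in>J. x \<in> C j}. b j) = 0"
  shows "(\<Sum>j\<in>{j\<in>J. C j \<noteq> {}}. b j) = 0"
proof -
  define J' where "J' = {j\<in>J. C j \<noteq> {}}"
  have fin: "finite J'" using \<open>finite J\<close> by (simp add: J'_def)
  have group: "(\<Sum>j\<in>{j\<in>J'. Sup (C j) = r}. b j) = 0" for r
  proof -
    have Sup_in: "Sup (C j) \<in> C j" if "j \<in> J'" for j
      using that cpt by (auto simp: J'_def intro!: closed_contains_Sup compact_imp_closed
          bounded_imp_bdd_above compact_imp_bounded)
    have Sup_ge: "x \<le> Sup (C j)" if "j \<in> J'" "x \<in> C j" for j x
      using that cpt by (auto simp: J'_def intro!: cSup_upper
          bounded_imp_bdd_above compact_imp_bounded)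
    have "\<forall>\<^sub>F e in at_right 0. \<forall>j\<in>J'. r + e \<in> C j \<longleftrightarrow> r \<in> C j \<and> Sup (C j) \<noteq> r"
    proof (intro eventually_ball_finite fin ballI)
      fix j assume j: "j \<in> J'"
      consider "r \<notin> C j" | "r \<in> C j" "Sup (C j) = r" | "r \<in> C j" "r < Sup (C j)"
        using Sup_ge[OF j] by fastforce
      then show "\<forall>\<^sub>F e in at_right 0. r + e \<in> C j \<longleftrightarrow> r \<in> C j \<and> Sup (C j) \<noteq> r"
      proof cases
        case 1
        have "open (- C j)" using j cpt by (auto simp: J'_def compact_imp_closed open_Compl)
        then obtain d where "d > 0" and d: "ball r d \<subseteq> - C j"
          using 1 by (meson ComplI open_contains_ball)
        have "\<forall>\<^sub>F e in at_right 0. e \<in> {0<..<d}"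
          using \<open>d > 0\<close> by (rule eventually_at_right_real)
        then show ?thesis
          by eventually_elim (use 1 d in \<open>auto simp: subset_iff dist_real_def\<close>)
      next
        case 2
        have "\<forall>\<^sub>F e in at_right (0::real). e > 0"
          by (rule eventually_at_right_less)
        then show ?thesis
          by eventually_elim (use 2 Sup_ge[OF j] in fastforce)
      next
        case 3
        have "\<forall>\<^sub>F e in at_right 0. e \<in> {0<..<Sup (C j) - r}"
          using 3 by (intro eventually_at_right_real) auto
        then show ?thesis
        proof eventually_elim
          case (elim e)
          have "is_interval (C j)" using j cvx by (auto simp: J'_def)
          then have "r + e \<in> C j"
            by (rule mem_is_interval_1_I[OF _ 3(1) Sup_in[OF j]]) (use elim in auto)
          with 3 show ?case by auto
        qed
      qed
    qed
    then obtain e where e: "\<forall>j\<in>J'. r + e \<in> C j \<longleftrightarrow> r \<in> C j \<and> Sup (C j) \<noteq> r"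
      using eventually_happens trivial_limit_at_right_real by blast
    have "(\<Sum>j\<in>{j\<in>J. r \<in> C j}. b j)
        = (\<Sum>j\<in>{j\<in>J. r + e \<in> C j} \<union> {j\<in>J'. Sup (C j) = r}. b j)"
      using e Sup_in by (intro sum.cong) (auto simp: J'_def)
    also have "\<dots> = (\<Sum>j\<in>{j\<in>J. r + e \<in> C j}. b j) + (\<Sum>j\<in>{j\<in>J'. Sup (C j) = r}. b j)"
      using e \<open>finite J\<close> by (intro sum.union_disjoint) (auto simp: J'_def)
    finally show ?thesis using rel by simp
  qed
  have "(\<Sum>j\<in>J'. b j) = (\<Sum>r\<in>(\<lambda>j. Sup (C j)) ` J'. \<Sum>j\<in>{j\<in>J'. Sup (C j) = r}. b j)"
    using fin by (intro sum.group[symmetric]) auto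
  then have "(\<Sum>j\<in>J'. b j) = 0" by (simp add: group)
  then show ?thesis by (simp add: J'_def)
qed

text \<open>Function types carry no vector space structure here, so convexity is spelled out.\<close>
definition fun_convex :: "('i \<Rightarrow> real) set \<Rightarrow> bool" where
  "fun_convex C \<longleftrightarrow> (\<forall>x\<in>C. \<forall>y\<in>C. \<forall>u\<in>{0..1}. (\<lambda>i. (1 - u) * x i + u * y i) \<in> C)"

text \<open>Induction on the coordinates that may vary, those outside \<open>I\<close> being frozen
  at \<open>a\<close>. The relation in the hyperplane \<open>x i = r\<close> concerns the nonempty
  slices, and this is the hypothesis of the interval case for the projections to coordinate
  \<open>i\<close>.\<close>

lemma euler_relation_fun:
  fixes C :: "'j \<Rightarrow> ('i \<Rightarrow> real) set" and b :: "'j \<Rightarrow> real"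
  assumes "finite I" and "finite J"
    and "\<And>j. j \<in> J \<Longrightarrow> compact (C j)"
    and "\<And>j. j \<in> J \<Longrightarrow> fun_convex (C j)"
    and "\<And>j i x. \<lbrakk>j \<in> J; x \<in> C j; i \<notin> I\<rbrakk> \<Longrightarrow> x i = a i"
    and "\<And>x. (\<Sum>j\<in>{j\<in>J. x \<in> C j}. b j) = 0"
  shows "(\<Sum>j\<in>{j\<in>J. C j \<noteq> {}}. b j) = 0"
  using assms
proof (induction I arbitrary: C a rule: finite_induct)
  case empty
  have "x = a" if "j \<in> J" "x \<in> C j" for j x
    using empty.prems(4)[OF that] by auto
  then have "{j\<in>J. C j \<noteq> {}} = {j\<in>J. a \<in> C j}" by blast
  then show ?case using empty.prems(5) by simp
next
  case (insert i I)
  note prems = insert.prems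
  define slice where "slice r j = C j \<inter> {x. x i = r}" for r j
  have slices: "(\<Sum>j\<in>{j\<in>J. slice r j \<noteq> {}}. b j) = 0" for r
  proof (rule insert.IH[where a = "a(i := r)"])
    have "closed {x::'i \<Rightarrow> real. x i = r}"
      by (intro closed_Collect_eq continuous_on_product_coordinates continuous_on_const)
    then show "compact (slice r j)" if "j \<in> J" for j
      using prems(2)[OF that] by (auto simp: slice_def compact_Int_closed)
    show "fun_convex (slice r j)" if "j \<in> J" for j
      using prems(3)[OF that] by (auto simp: slice_def fun_convex_def algebra_simps)
    show "x k = (a(i := r)) k" if "j \<in> J" "x \<in> slice r j" "k \<notin> I" for j k x
      using that prems(4)[of j x k] by (auto simp: slice_def)
    show "(\<Sum>j\<in>{j\<in>J. x \<in> slice r j}. b j) = 0" for x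
      using prems(5)[of x] by (cases "x i = r") (auto simp: slice_def)
  qed fact
  have "(\<Sum>j\<in>{j\<in>J. (\<lambda>x. x i) ` C j \<noteq> {}}. b j) = 0"
  proof (rule euler_relation_intervals)
    show "compact ((\<lambda>x. x i) ` C j)" if "j \<in> J" for j
      using prems(2)[OF that]
      by (intro compact_continuous_image continuous_on_subset[OF continuous_on_product_coordinates]) auto
    show "is_interval ((\<lambda>x. x i) ` C j)" if "j \<in> J" for j
      unfolding is_interval_convex_1 convex_alt
    proof (intro ballI allI impI)
      fix p q u :: real
      assume "p \<in> (\<lambda>x. x i) ` C j" "q \<in> (\<lambda>x. x i) ` C j" and u: "0 \<le> u \<and> u \<le> 1"
      then obtain x y where xy: "x \<in> C j" "y \<in> C j" "p = x i" "q = y i" by blast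
      then have "(\<lambda>k. (1 - u) * x k + u * y k) \<in> C j"
        using prems(3)[OF that] u by (auto simp: fun_convex_def)
      then show "(1 - u) *\<^sub>R p + u *\<^sub>R q \<in> (\<lambda>x. x i) ` C j"
        using xy by (auto intro: rev_image_eqI)
    qed
    show "(\<Sum>j\<in>{j\<in>J. r \<in> (\<lambda>x. x i) ` C j}. b j) = 0" for r
    proof -
      have "{j\<in>J. r \<in> (\<lambda>x. x i) ` C j} = {j\<in>J. slice r j \<noteq> {}}"
        by (auto simp: slice_def)
      then show ?thesis using slices by simp
    qed
  qed fact
  then show ?case by simp
qed

lemma euler_relation:
  fixes C :: "'j \<Rightarrow> (real^'n) set" and b :: "'j \<Rightarrow> real"
  assumes "finite J"
    and cpt: "\<And>j. j \<in> J \<Longrightarrow> compact (C j)"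
    and cvx: "\<And>j. j \<in> J \<Longrightarrow> convex (C j)"
    and rel: "\<And>x. (\<Sum>j\<in>{j\<in>J. x \<in> C j}. b j) = 0"
  shows "(\<Sum>j\<in>{j\<in>J. C j \<noteq> {}}. b j) = 0"
proof -
  have "(\<Sum>j\<in>{j\<in>J. vec_nth ` C j \<noteq> {}}. b j) = 0"
  proof (rule euler_relation_fun[where I = UNIV])
    have "continuous_on UNIV (vec_nth :: real^'n \<Rightarrow> 'n \<Rightarrow> real)"
      by (intro continuous_on_coordinatewise_then_product continuous_intros)
    then show "compact (vec_nth ` C j)" if "j \<in> J" for j
      using cpt[OF that] by (meson compact_continuous_image continuous_on_subset subset_UNIV)
    show "fun_convex (vec_nth ` C j)" if "j \<in> J" for j
      unfolding fun_convex_def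
    proof clarify
      fix u :: real and x y assume "u \<in> {0..1}" "x \<in> C j" "y \<in> C j"
      then have "(1 - u) *\<^sub>R x + u *\<^sub>R y \<in> C j"
        using cvx[OF that] by (auto simp: convex_alt)
      then show "(\<lambda>i. (1 - u) * x $ i + u * y $ i) \<in> vec_nth ` C j"
        by (rule rev_image_eqI) (auto simp: fun_eq_iff)
    qed
    show "(\<Sum>j\<in>{j\<in>J. x \<in> vec_nth ` C j}. b j) = 0" for x
    proof -
      have "{j\<in>J. x \<in> vec_nth ` C j} = {j\<in>J. vec_lambda x \<in> C j}"
        by (auto simp: image_iff) (metis vec_lambda_beta ext)+
      then show ?thesis using rel by simp
    qed
  qed (use \<open>finite J\<close> in auto)
  then show ?thesis by simp
qed

section \<open>Ehrhart polynomials of shifted dilates\<close>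

lemma lattice_points_add: "x \<in> lattice_points \<Longrightarrow> y \<in> lattice_points \<Longrightarrow> x + y \<in> lattice_points"
  and lattice_points_diff: "x \<in> lattice_points \<Longrightarrow> y \<in> lattice_points \<Longrightarrow> x - y \<in> lattice_points"
  and lattice_points_uminus: "x \<in> lattice_points \<Longrightarrow> - x \<in> lattice_points"
  and lattice_points_scale: "k \<in> \<int> \<Longrightarrow> x \<in> lattice_points \<Longrightarrow> k *\<^sub>R x \<in> lattice_points"
  by (simp_all add: lattice_points_def)

lemma lattice_points_sum: "(\<And>a. a \<in> A \<Longrightarrow> f a \<in> lattice_points) \<Longrightarrow> sum f A \<in> lattice_points"
  by (simp add: lattice_points_def Ints_sum)

lemma finite_lattice_points:
  fixes X :: "(real^'n) set"
  assumes "bounded X"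
  shows "finite (X \<inter> lattice_points)"
proof -
  obtain R where R: "\<And>x. x \<in> X \<Longrightarrow> norm x \<le> R"
    using assms by (auto simp: bounded_iff)
  define K where "K = {k::real. k \<in> \<int> \<and> - R \<le> k \<and> k \<le> R}"
  have "finite (vec_lambda ` (UNIV \<rightarrow>\<^sub>E K) :: (real^'n) set)"
    unfolding K_def by (intro finite_imageI finite_PiE finite_int_segment) auto
  moreover have "X \<inter> lattice_points \<subseteq> vec_lambda ` (UNIV \<rightarrow>\<^sub>E K)"
  proof
    fix x assume x: "x \<in> X \<inter> lattice_points"
    have "\<bar>x $ i\<bar> \<le> R" for i
      using component_le_norm_cart[of x i] R[of x] x by auto
    then have "x $ i \<in> K" for i
      using x by (simp add: K_def lattice_points_def abs_le_iff minus_le_iff)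
    then have "vec_nth x \<in> UNIV \<rightarrow>\<^sub>E K" by auto
    then show "x \<in> vec_lambda ` (UNIV \<rightarrow>\<^sub>E K)"
      by (metis image_eqI vec_nth_inverse)
  qed
  ultimately show ?thesis by (rule rev_finite_subset)
qed

text \<open>Scaling convex coefficients by \<open>r\<close> gives vertex weights of total mass
  \<open>r\<close>. The case \<open>r = 0\<close> stands apart because weights cannot be normalised
  there.\<close>

lemma dilate_convex_hull_iff:
  fixes S :: "'a::real_vector set"
  assumes "finite S" "S \<noteq> {}" "0 \<le> r"
  shows "(\<exists>x\<in>convex hull S. y = r *\<^sub>R x) \<longleftrightarrow>
    (\<exists>u. (\<forall>s\<in>S. 0 \<le> u s) \<and> sum u S = r \<and> (\<Sum>s\<in>S. u s *\<^sub>R s) = y)" (is "?L \<longleftrightarrow> ?R")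
proof
  assume ?L
  then obtain u where "\<forall>s\<in>S. 0 \<le> u s" "sum u S = 1" "y = r *\<^sub>R (\<Sum>s\<in>S. u s *\<^sub>R s)"
    by (auto simp: convex_hull_finite[OF \<open>finite S\<close>])
  then show ?R using \<open>0 \<le> r\<close>
    by (intro exI[of _ "\<lambda>s. r * u s"]) (auto simp: scaleR_sum_right simp flip: sum_distrib_left)
next
  assume ?R
  then obtain u where u: "\<forall>s\<in>S. 0 \<le> u s" "sum u S = r" "(\<Sum>s\<in>S. u s *\<^sub>R s) = y" by blast
  show ?L
  proof (cases "r = 0")
    case True
    then have "\<forall>s\<in>S. u s = 0"
      using u \<open>finite S\<close> by (simp add: sum_nonneg_eq_0_iff)
    then have "y = 0" using u by auto
    then show ?thesis using True \<open>S \<noteq> {}\<close> by (auto simp: hull_inc)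
  next
    case False
    have "(\<Sum>s\<in>S. (u s / r) *\<^sub>R s) \<in> convex hull S"
      using u False \<open>0 \<le> r\<close>
      by (auto simp: convex_hull_finite[OF \<open>finite S\<close>] intro!: exI[of _ "\<lambda>s. u s / r"]
          simp flip: sum_divide_distrib)
    moreover have "y = r *\<^sub>R (\<Sum>s\<in>S. (u s / r) *\<^sub>R s)"
      using u False by (simp add: scaleR_sum_right)
    ultimately show ?thesis by blast
  qed
qed

section \<open>Inclusion-exclusion for polytopes of vertex weights\<close>

lemma compact_fun_box:
  fixes K :: "'i \<Rightarrow> real set"
  assumes "\<And>i. compact (K i)"
  shows "compact {f. \<forall>i. f i \<in> K i}"
proof -
  have "compactin (product_topology (\<lambda>_. euclidean) UNIV) (Pi\<^sub>E UNIV K)"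
    using assms by (simp add: compactin_PiE)
  moreover have "Pi\<^sub>E UNIV K = {f. \<forall>i. f i \<in> K i}" by auto
  ultimately show ?thesis by (simp add: euclidean_product_topology)
qed

lemma sum_alternating_Pow:
  assumes "finite T" "T \<noteq> {}"
  shows "(\<Sum>A\<in>Pow T. (-1) ^ card A) = (0::real)"
proof -
  have "(0::real) = (\<Prod>t\<in>T. 1 - 1)" using assms by (simp add: power_0_left)
  also have "\<dots> = (\<Sum>A\<in>Pow T. (-1) ^ card A)"
    using assms by (subst prod_diff_conv_sum) auto
  finally show ?thesis by simp
qed

text \<open>The vertex weights \<open>\<alpha>\<close> representing \<open>y\<close> with total mass \<open>r \<ge> card S\<close> always have an entry that
  is at least 1, so their polytope is the union over \<open>s \<in> S\<close> of the parts with \<open>\<alpha> s \<ge> 1\<close>. The relation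
  is inclusion-exclusion for the Euler characteristic of this union.\<close>
lemma dilate_relation:
  fixes S :: "(real^'n) set"
  assumes "finite S" "S \<noteq> {}" "real (card S) \<le> r"
  shows "(\<Sum>A\<in>{A\<in>Pow S. \<exists>x\<in>convex hull S. y = (r - card A) *\<^sub>R x + \<Sum>A}. (-1) ^ card A) = (0::real)"
proof -
  \<comment> \<open>The weights of total mass \<open>r\<close> that represent \<open>y\<close> and
    are at least 1 on \<open>A\<close>. The upper bound \<open>r\<close> makes these sets compact;
    entries off \<open>S\<close> are 0 so that only the coordinates in \<open>S\<close>
    vary.\<close>
  define W where "W A = {\<alpha>. \<forall>s. \<alpha> s \<in> (if s \<in> S then {of_bool (s \<in> A)..r} else {0})}
    \<inter> {\<alpha>. (\<Sum>s\<in>S. \<alpha> s) = r} \<inter> {\<alpha>. (\<Sum>s\<in>S. \<alpha> s *\<^sub>R s) = y}" for A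
  have entry: "\<alpha> s \<in> (if s \<in> S then {of_bool (s \<in> A)..r} else {0})" if "\<alpha> \<in> W A" for \<alpha> A s
    using that unfolding W_def by blast
  have "(\<Sum>A\<in>{A\<in>Pow S. W A \<noteq> {}}. (-1) ^ card A) = (0::real)"
  proof (rule euler_relation_fun[where I = S and a = "\<lambda>_. 0"])
    fix A assume "A \<in> Pow S"
    have coord: "continuous_on UNIV (\<lambda>\<alpha>::real^'n \<Rightarrow> real. \<alpha> s)" for s
      by (rule continuous_on_product_coordinates)
    show "compact (W A)"
      unfolding W_def
      by (intro compact_Int_closed compact_fun_box closed_Collect_eq continuous_intros coord) auto
    have "(\<lambda>s. (1 - u) * \<alpha> s + u * \<beta> s) \<in> W A" if "\<alpha> \<in> W A" "\<beta> \<in> W A" and u: "u \<in> {0..1}" for \<alpha> \<beta> u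
    proof -
      have "(1 - u) * \<alpha> s + u * \<beta> s \<in> (if s \<in> S then {of_bool (s \<in> A)..r} else {0})" for s
      proof -
        have "convex (if s \<in> S then {of_bool (s \<in> A)..r} else {0})" by simp
        moreover have "\<alpha> s \<in> (if s \<in> S then {of_bool (s \<in> A)..r} else {0})"
          "\<beta> s \<in> (if s \<in> S then {of_bool (s \<in> A)..r} else {0})"
          using that entry by blast+
        ultimately show ?thesis using u unfolding convex_alt by fastforce
      qed
      moreover have "(\<Sum>s\<in>S. (1 - u) * \<alpha> s + u * \<beta> s) = r"
      proof -
        have "(\<Sum>s\<in>S. (1 - u) * \<alpha> s + u * \<beta> s) = (1 - u) * sum \<alpha> S + u * sum \<beta> S"
          by (simp add: sum.distrib sum_distrib_left)
        then show ?thesis using that by (simp add: W_def algebra_simps)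
      qed
      moreover have "(\<Sum>s\<in>S. ((1 - u) * \<alpha> s + u * \<beta> s) *\<^sub>R s) = y"
      proof -
        have "(\<Sum>s\<in>S. ((1 - u) * \<alpha> s + u * \<beta> s) *\<^sub>R s)
          = (1 - u) *\<^sub>R (\<Sum>s\<in>S. \<alpha> s *\<^sub>R s) + u *\<^sub>R (\<Sum>s\<in>S. \<beta> s *\<^sub>R s)"
          by (simp add: scaleR_sum_right sum.distrib scaleR_add_left)
        then show ?thesis using that by (simp add: W_def algebra_simps)
      qed
      ultimately show ?thesis unfolding W_def by blast
    qed
    then show "fun_convex (W A)" by (auto simp: fun_convex_def)
    show "\<alpha> s = 0" if "\<alpha> \<in> W A" "s \<notin> S" for \<alpha> s
      using that by (auto simp: W_def dest: spec[of _ s])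
  next
    fix \<alpha> :: "real^'n \<Rightarrow> real"
    show "(\<Sum>A\<in>{A\<in>Pow S. \<alpha> \<in> W A}. (-1) ^ card A) = (0::real)"
    proof (cases "\<alpha> \<in> W {}")
      case False
      have "W A \<subseteq> W {}" for A
      proof
        fix \<alpha> assume \<alpha>: "\<alpha> \<in> W A"
        moreover have "\<alpha> s \<in> (if s \<in> S then {of_bool (s \<in> {})..r} else {0})" for s
          using entry[OF \<alpha>, of s] by (auto simp: of_bool_def split: if_splits)
        ultimately show "\<alpha> \<in> W {}" unfolding W_def by blast
      qed
      with False have "\<alpha> \<notin> W A" for A by blast
      then show ?thesis by simp
    next
      case True
      \<comment> \<open>The sets \<open>A\<close> with \<alpha> in \<open>W A\<close> are the
        subsets of \<open>T\<close>, so their alternating sum vanishes once \<open>T\<close> is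
        nonempty. If all entries were below 1, the total mass would be less than
        \<open>card S\<close>.\<close>
      define T where "T = {s\<in>S. 1 \<le> \<alpha> s}"
      have "T \<noteq> {}"
      proof
        assume "T = {}"
        then have "(\<Sum>s\<in>S. \<alpha> s) < (\<Sum>s\<in>S. 1)"
          using assms by (intro sum_strict_mono) (auto simp: T_def)
        then show False using True assms by (simp add: W_def)
      qed
      moreover have "{A\<in>Pow S. \<alpha> \<in> W A} = Pow T"
      proof (intro equalityI subsetI)
        fix A assume "A \<in> {A\<in>Pow S. \<alpha> \<in> W A}"
        then have A: "A \<subseteq> S" "\<alpha> \<in> W A" by auto
        have "1 \<le> \<alpha> s" if "s \<in> A" for s
          using entry[OF A(2), of s] A(1) that by auto
        with A(1) show "A \<in> Pow T" by (auto simp: T_def)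
      next
        fix A assume A: "A \<in> Pow T"
        have "\<alpha> s \<in> (if s \<in> S then {of_bool (s \<in> A)..r} else {0})" for s
        proof -
          have "\<alpha> s \<in> (if s \<in> S then {of_bool (s \<in> {})..r} else {0})"
            using True by (rule entry)
          then show ?thesis using A by (auto simp: T_def)
        qed
        then show "A \<in> {A\<in>Pow S. \<alpha> \<in> W A}"
          using True A unfolding W_def by (auto simp: T_def)
      qed
      ultimately show ?thesis
        using sum_alternating_Pow[of T] assms by (simp add: T_def)
    qed
  qed (use assms in auto)
  \<comment> \<open>Removing one unit of weight from each element of \<open>A\<close> turns the
    weights in \<open>W A\<close> into representations of \<open>y - \<Sum>A\<close> of total mass
    \<open>r - card A\<close>.\<close>
  moreover have "W A \<noteq> {} \<longleftrightarrow> (\<exists>x\<in>convex hull S. y = (r - card A) *\<^sub>R x + \<Sum>A)" if "A \<in> Pow S" for A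
  proof -
    have "finite A" using that assms finite_subset by auto
    have card: "(\<Sum>s\<in>S. of_bool (s \<in> A)) = real (card A)"
      using that assms by (simp add: of_bool_def sum.If_cases Int_absorb1)
    have sumA: "(\<Sum>s\<in>S. of_bool (s \<in> A) *\<^sub>R s) = \<Sum>A"
    proof -
      have "(\<Sum>s\<in>S. of_bool (s \<in> A) *\<^sub>R s) = (\<Sum>s\<in>S. if s \<in> A then s else 0)"
        by (intro sum.cong) auto
      then show ?thesis using that assms by (simp add: sum.If_cases Int_absorb1)
    qed
    have "card A \<le> card S" using that assms by (simp add: card_mono)
    then have nonneg: "0 \<le> r - card A" using assms by linarith
    have "W A \<noteq> {} \<longleftrightarrow>
      (\<exists>u. (\<forall>s\<in>S. 0 \<le> u s) \<and> sum u S = r - card A \<and> (\<Sum>s\<in>S. u s *\<^sub>R s) = y - \<Sum>A)"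
    proof
      assume "W A \<noteq> {}"
      then obtain \<alpha> where \<alpha>: "\<alpha> \<in> W A" by blast
      have "\<forall>s\<in>S. of_bool (s \<in> A) \<le> \<alpha> s"
        using entry[OF \<alpha>] by (metis atLeastAtMost_iff)
      moreover have "sum \<alpha> S = r" "(\<Sum>s\<in>S. \<alpha> s *\<^sub>R s) = y"
        using \<alpha> by (auto simp: W_def)
      ultimately show "\<exists>u. (\<forall>s\<in>S. 0 \<le> u s) \<and> sum u S = r - card A \<and> (\<Sum>s\<in>S. u s *\<^sub>R s) = y - \<Sum>A"
        by (intro exI[of _ "\<lambda>s. \<alpha> s - of_bool (s \<in> A)"])
          (simp add: sum_subtractf scaleR_diff_left card sumA)
    next
      assume "\<exists>u. (\<forall>s\<in>S. 0 \<le> u s) \<and> sum u S = r - card A \<and> (\<Sum>s\<in>S. u s *\<^sub>R s) = y - \<Sum>A"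
      then obtain u where u: "\<forall>s\<in>S. 0 \<le> u s" "sum u S = r - card A" "(\<Sum>s\<in>S. u s *\<^sub>R s) = y - \<Sum>A"
        by blast
      define \<alpha> where "\<alpha> s = (if s \<in> S then u s + of_bool (s \<in> A) else 0)" for s
      have sum\<alpha>: "sum \<alpha> S = r" "(\<Sum>s\<in>S. \<alpha> s *\<^sub>R s) = y"
        using u by (simp_all add: \<alpha>_def sum.distrib scaleR_add_left card sumA)
      have "\<alpha> s \<le> r" if "s \<in> S" for s
        using member_le_sum[of s S \<alpha>] that u assms sum\<alpha> by (auto simp: \<alpha>_def)
      then have "\<alpha> \<in> W A"
        using u sum\<alpha> by (auto simp: W_def \<alpha>_def)
      then show "W A \<noteq> {}" by blast
    qed
    also have "\<dots> \<longleftrightarrow> (\<exists>x\<in>convex hull S. y - \<Sum>A = (r - card A) *\<^sub>R x)"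
      using dilate_convex_hull_iff[OF assms(1,2) nonneg] by simp
    finally show ?thesis by (simp add: diff_eq_eq)
  qed
  then have "{A\<in>Pow S. W A \<noteq> {}} = {A\<in>Pow S. \<exists>x\<in>convex hull S. y = (r - card A) *\<^sub>R x + \<Sum>A}"
    by blast
  ultimately show ?thesis by simp
qed

text \<open>Dilation factor and translation vector are independent, unlike in \<open>ehr\<close> of
  a translate, where \<open>t\<close> scales both. The factor is real because \<open>tP\<close> is
  later treated as a fractional dilate of a lattice polytope.\<close>

definition dilate_count :: "(real^'n) set \<Rightarrow> real \<Rightarrow> real^'n \<Rightarrow> nat" where
  "dilate_count P r c = card {z\<in>lattice_points. \<exists>x\<in>P. z = r *\<^sub>R x + c}"

section \<open>Finiteness and invariance of lattice point counts\<close>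

lemma finite_dilate:
  fixes P :: "(real^'n) set"
  assumes "bounded P"
  shows "finite {z\<in>lattice_points. \<exists>x\<in>P. z = r *\<^sub>R x + c}"
proof -
  have "bounded ((\<lambda>x. c + x) ` ((\<lambda>x. r *\<^sub>R x) ` P))"
    using assms by (intro bounded_translation bounded_scaling)
  from finite_lattice_points[OF this] show ?thesis
    by (rule rev_finite_subset) (auto simp: add.commute)
qed

lemma dilate_count_shift:
  assumes "a \<in> lattice_points"
  shows "dilate_count P r (c + a) = dilate_count P r c"
proof -
  have "bij_betw (\<lambda>z. z - a) {z\<in>lattice_points. \<exists>x\<in>P. z = r *\<^sub>R x + (c + a)}
     {z\<in>lattice_points. \<exists>x\<in>P. z = r *\<^sub>R x + c}"
    by (rule bij_betw_byWitness[where f' = "\<lambda>z. z + a"])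
      (use assms in \<open>auto simp: algebra_simps intro: lattice_points_add lattice_points_diff\<close>)
  then show ?thesis unfolding dilate_count_def by (rule bij_betw_same_card)
qed

lemma dilate_count_uminus:
  assumes "uminus ` P = P"
  shows "dilate_count P r (- c) = dilate_count P r c"
proof -
  have neg: "- x \<in> P" if "x \<in> P" for x using assms that by blast
  have "bij_betw uminus {z\<in>lattice_points. \<exists>x\<in>P. z = r *\<^sub>R x + - c}
     {z\<in>lattice_points. \<exists>x\<in>P. z = r *\<^sub>R x + c}"
    by (rule bij_betw_byWitness[where f' = uminus])
      (auto simp: intro!: bexI[OF _ neg] dest: lattice_points_uminus)
  then show ?thesis unfolding dilate_count_def by (rule bij_betw_same_card)
qed

text \<open>Sums \<open>dilate_relation\<close> over all lattice points. The set belonging to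
  \<open>A\<close> is shifted by the lattice vector \<open>\<Sum>A\<close>, which leaves its count
  unchanged, so only the dilation factor depends on \<open>A\<close>.\<close>

lemma alternating_dilate_count:
  fixes S :: "(real^'n) set"
  assumes "finite S" "S \<noteq> {}" "S \<subseteq> lattice_points" "real (card S) \<le> r"
  shows "(\<Sum>A\<in>Pow S. (-1) ^ card A * real (dilate_count (convex hull S) (r - card A) c)) = 0"
proof -
  define D where "D A = {z\<in>lattice_points. \<exists>x\<in>convex hull S. z = (r - card A) *\<^sub>R x + (c + \<Sum>A)}" for A
  define Z where "Z = (\<Union>A\<in>Pow S. D A)"
  have "bounded (convex hull S)"
    using \<open>finite S\<close> by (simp add: finite_imp_compact compact_convex_hull compact_imp_bounded)
  then have "finite Z"
    unfolding Z_def D_def using \<open>finite S\<close> by (intro finite_UN_I finite_dilate) auto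
  have "(\<Sum>A\<in>Pow S. (-1) ^ card A * real (dilate_count (convex hull S) (r - card A) c))
      = (\<Sum>A\<in>Pow S. \<Sum>z\<in>Z. if z \<in> D A then (-1) ^ card A else 0)"
  proof (rule sum.cong)
    fix A assume A: "A \<in> Pow S"
    then have "\<Sum>A \<in> lattice_points"
      using assms by (intro lattice_points_sum) auto
    then have "dilate_count (convex hull S) (r - card A) c = card (D A)"
      using dilate_count_shift[of "\<Sum>A" "convex hull S" "r - card A" c]
      by (simp add: dilate_count_def D_def)
    moreover have "Z \<inter> D A = D A" using A by (auto simp: Z_def)
    ultimately show "(-1) ^ card A * real (dilate_count (convex hull S) (r - card A) c)
        = (\<Sum>z\<in>Z. if z \<in> D A then (-1) ^ card A else 0)"
      using \<open>finite Z\<close> by (simp add: sum.If_cases)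
  qed simp
  also have "\<dots> = (\<Sum>z\<in>Z. \<Sum>A\<in>Pow S. if z \<in> D A then (-1) ^ card A else 0)"
    by (rule sum.swap)
  also have "\<dots> = (\<Sum>z\<in>Z. 0)"
  proof (rule sum.cong)
    fix z assume "z \<in> Z"
    then have "z \<in> lattice_points" by (auto simp: Z_def D_def)
    then have "z \<in> D A \<longleftrightarrow> (\<exists>x\<in>convex hull S. z - c = (r - card A) *\<^sub>R x + \<Sum>A)" for A
      by (auto simp: D_def algebra_simps)
    then have "(\<Sum>A\<in>{A\<in>Pow S. z \<in> D A}. (-1) ^ card A) = (0::real)"
      using dilate_relation[OF assms(1,2,4), of "z - c"] by simp
    then show "(\<Sum>A\<in>Pow S. if z \<in> D A then (-1) ^ card A else 0) = (0::real)"
      using \<open>finite S\<close> by (subst sum.inter_filter[symmetric]) auto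
  qed simp
  finally show ?thesis by simp
qed

text \<open>The hypothesis says that the \<open>card S\<close>-th forward difference of
  \<open>f\<close> vanishes, and the conclusion is Newton's forward difference formula. Subsets in
  place of binomial coefficients allow induction on \<open>S\<close>: pairing \<open>A\<close> with
  \<open>insert s A\<close> passes from \<open>f\<close> to its first difference
  \<open>g\<close>.\<close>

lemma binomial_sum_of_alternating_zero:
  fixes f :: "nat \<Rightarrow> real"
  assumes "finite S"
    and "\<And>m. (\<Sum>A\<in>Pow S. (-1) ^ card A * f (m + card S - card A)) = 0"
  shows "\<exists>a. \<forall>m. f m = (\<Sum>i<card S. a i * real (m choose i))"
  using assms
proof (induction S arbitrary: f rule: finite_induct)
  case empty
  then show ?case by simp
next
  case (insert s S)
  define g where "g m = f (Suc m) - f m" for m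
  have "(\<Sum>A\<in>Pow S. (-1) ^ card A * g (m + card S - card A)) = 0" for m
  proof -
    have inj: "inj_on (insert s) (Pow S)"
      using insert.hyps by (auto intro!: inj_onI)
    have cardA: "card (insert s A) = Suc (card A)" "card A \<le> card S" if "A \<in> Pow S" for A
      using that insert.hyps by (auto simp: card_mono finite_subset card_insert_if)
    have "0 = (\<Sum>A\<in>Pow (insert s S). (-1) ^ card A * f (m + card (insert s S) - card A))"
      using insert.prems by simp
    also have "\<dots> = (\<Sum>A\<in>Pow S. (-1) ^ card A * f (m + card (insert s S) - card A))
       + (\<Sum>A\<in>insert s ` Pow S. (-1) ^ card A * f (m + card (insert s S) - card A))"
      unfolding Pow_insert using insert.hyps by (intro sum.union_disjoint) auto
    also have "(\<Sum>A\<in>insert s ` Pow S. (-1) ^ card A * f (m + card (insert s S) - card A))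
        = (\<Sum>A\<in>Pow S. - ((-1) ^ card A * f (m + card S - card A)))"
      using insert.hyps by (subst sum.reindex[OF inj]) (auto simp: cardA intro!: sum.cong)
    also have "(\<Sum>A\<in>Pow S. (-1) ^ card A * f (m + card (insert s S) - card A))
        = (\<Sum>A\<in>Pow S. (-1) ^ card A * f (Suc (m + card S - card A)))"
      using insert.hyps cardA(2) by (intro sum.cong) (auto simp: Suc_diff_le trans_le_add2)
    finally show ?thesis
      by (simp add: g_def algebra_simps sum_subtractf sum_negf)
  qed
  from insert.IH[OF this] obtain a where a: "g m = (\<Sum>i<card S. a i * real (m choose i))" for m
    by blast
  \<comment> \<open>Summing up \<open>g\<close> raises each lower index by one, by Pascal's
    rule.\<close>
  have f: "f m = f 0 + (\<Sum>i<card S. a i * real (m choose Suc i))" for m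
  proof (induction m)
    case (Suc m)
    have "f (Suc m) = f m + g m" by (simp add: g_def)
    then show ?case using Suc by (simp add: a sum.distrib algebra_simps)
  qed simp
  have "f m = (\<Sum>i<card (insert s S). (case i of 0 \<Rightarrow> f 0 | Suc i \<Rightarrow> a i) * real (m choose i))" for m
    using insert.hyps by (subst f) (simp add: sum.lessThan_Suc_shift del: sum.lessThan_Suc)
  then show ?case by blast
qed

lemma choose_poly: "\<exists>p::real poly. degree p \<le> i \<and> (\<forall>m. real (m choose i) = poly p (real m))"
proof (intro exI conjI allI)
  define p :: "real poly" where "p = smult (1 / fact i) (\<Prod>j<i. [:- real j, 1:])"
  have "degree (\<Prod>j<i. [:- real j, 1:]) \<le> (\<Sum>j<i. (degree \<circ> (\<lambda>j. [:- real j, 1:])) j)"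
    by (rule degree_prod_sum_le) simp
  then show "degree p \<le> i" by (simp add: p_def)
  show "real (m choose i) = poly p (real m)" for m
    by (simp add: p_def binomial_gbinomial gbinomial_prod_rev poly_prod atLeast0LessThan)
qed

text \<open>The vanishing \<open>card S\<close>-th difference in \<open>m\<close> makes the count a
  combination of the polynomials \<open>m choose i\<close> with \<open>i < card S\<close>.\<close>

lemma shifted_ehrhart_polynomial:
  fixes S :: "(real^'n) set"
  assumes "finite S" "S \<noteq> {}" "S \<subseteq> lattice_points" "0 \<le> r"
  shows "\<exists>p. degree p < card S \<and>
    (\<forall>m::nat. real (dilate_count (convex hull S) (real m + r) c) = poly p (real m))"
proof -
  define f where "f m = real (dilate_count (convex hull S) (real m + r) c)" for m :: nat
  have "(\<Sum>A\<in>Pow S. (-1) ^ card A * f (m + card S - card A)) = 0" for m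
  proof -
    have "f (m + card S - card A)
        = real (dilate_count (convex hull S) ((real (m + card S) + r) - card A) c)" if "A \<in> Pow S" for A
    proof -
      have "card A \<le> m + card S" using that assms by (simp add: card_mono trans_le_add2)
      then show ?thesis by (simp add: f_def of_nat_diff algebra_simps)
    qed
    then show ?thesis
      using alternating_dilate_count[OF assms(1-3), of "real (m + card S) + r" c] assms(4) by simp
  qed
  from binomial_sum_of_alternating_zero[OF \<open>finite S\<close> this]
  obtain a where a: "f m = (\<Sum>i<card S. a i * real (m choose i))" for m by blast
  obtain q :: "nat \<Rightarrow> real poly"
    where q: "\<And>i. degree (q i) \<le> i" "\<And>i m. real (m choose i) = poly (q i) (real m)"
    using choose_poly by metis
  have "degree (\<Sum>i<card S. smult (a i) (q i)) < card S"
    using assms q(1) by (intro degree_sum_less) (auto simp: card_gt_0_iff intro: le_less_trans[OF degree_smult_le] le_less_trans)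
  then show ?thesis
    by (intro exI[of _ "\<Sum>i<card S. smult (a i) (q i)"]) (simp add: poly_sum a q(2) flip: f_def)
qed

text \<open>The degree bound is uniform in the residue class and in the translation vector.\<close>
corollary ehrhart_constituent:
  fixes P :: "(real^'n) set"
  assumes "finite S" "S \<noteq> {}" "S \<subseteq> lattice_points"
    and "convex hull S = (\<lambda>x. real D *\<^sub>R x) ` P" and "D > 0"
  shows "\<exists>p. degree p < card S \<and>
    (\<forall>t::nat. t mod D = k mod D \<longrightarrow> real (dilate_count P (real t) c) = poly p (real t))"
proof -
  \<comment> \<open>For \<open>t\<close> in the residue class, \<open>tP\<close> is the dilate of
    the lattice polytope \<open>DP\<close> by \<open>t div D + r / D\<close>.\<close>
  define r where "r = real (k mod D)"
  obtain p where p: "degree p < card S"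
    "\<And>m::nat. real (dilate_count (convex hull S) (real m + r / D) c) = poly p (real m)"
    using shifted_ehrhart_polynomial[OF assms(1-3), of "r / D" c] by (auto simp: r_def)
  define q where "q = pcompose p [:- r / D, 1 / D:]"
  have "degree q < card S"
    using p(1) \<open>D > 0\<close> by (simp add: q_def degree_pcompose)
  moreover have "real (dilate_count P (real t) c) = poly q (real t)" if "t mod D = k mod D" for t :: nat
  proof -
    have t: "real t = real D * real (t div D) + r"
      using that by (metis r_def mult_div_mod_eq of_nat_add of_nat_mult)
    have "dilate_count (convex hull S) (real (t div D) + r / D) c = dilate_count P (real t) c"
      using \<open>D > 0\<close> by (simp add: dilate_count_def assms(4) t algebra_simps)
    moreover have "poly q (real t) = poly p (real (t div D))"
      using \<open>D > 0\<close> by (simp add: q_def poly_pcompose t field_simps)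
    ultimately show ?thesis using p(2) by metis
  qed
  ultimately show ?thesis by blast
qed

section \<open>Rational approximation and extrapolation\<close>

lemma common_denominator:
  assumes "finite X" "X \<subseteq> \<rat>"
  shows "\<exists>N::nat. 0 < N \<and> (\<forall>x\<in>X. real N * x \<in> \<int>)"
  using assms
proof (induction X rule: finite_induct)
  case (insert y X)
  then obtain N :: nat where N: "0 < N" "\<forall>x\<in>X. real N * x \<in> \<int>" by auto
  obtain i :: int and n :: nat where y: "y = real_of_int i / real n" "n \<noteq> 0"
    using insert.prems by (auto simp: Rats_eq_int_div_nat)
  have "real (N * n) * x \<in> \<int>" if "x \<in> X" for x
  proof -
    have "real n * (real N * x) \<in> \<int>" using Ints_mult[of "real n" "real N * x"] that N by simp
    then show ?thesis by (simp add: mult_ac)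
  qed
  moreover have "real (N * n) * y \<in> \<int>" using y by simp
  ultimately show ?case using N y by (intro exI[of _ "N * n"]) auto
qed auto

lemma common_denominator_vec:
  fixes V :: "(real^'n) set"
  assumes "finite V" "\<And>v. v \<in> V \<Longrightarrow> rational_vec v"
  shows "\<exists>N::nat. 0 < N \<and> (\<forall>v\<in>V. real N *\<^sub>R v \<in> lattice_points)"
proof -
  have "finite (\<Union>v\<in>V. range (vec_nth v))" using assms by auto
  moreover have "(\<Union>v\<in>V. range (vec_nth v)) \<subseteq> \<rat>"
    using assms(2) by (auto simp: rational_vec_def)
  ultimately obtain N :: nat where "0 < N" "\<forall>x\<in>(\<Union>v\<in>V. range (vec_nth v)). real N * x \<in> \<int>"
    using common_denominator by blast
  then show ?thesis by (intro exI[of _ N]) (auto simp: lattice_points_def)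
qed

lemma Rats_approx:
  fixes x :: real
  assumes "0 < d"
  shows "\<exists>q\<in>\<rat>. \<bar>q - x\<bar> < d"
proof -
  obtain q where "q \<in> \<rat>" "x < q" "q < x + d"
    using Rats_dense_in_real[of x "x + d"] assms by auto
  then show ?thesis by (intro bexI[of _ q]) auto
qed

text \<open>Induction on \<open>K\<close>. If \<open>x i\<close> is a rational affine combination of
  the other values, its approximation is forced by theirs; otherwise \<open>x i\<close> occurs in no
  relation and any close rational will do.\<close>

lemma rational_approx_relations:
  fixes x :: "'k \<Rightarrow> real"
  assumes "finite K" "0 < d"
  shows "\<exists>y. (\<forall>k\<in>K. y k \<in> \<rat> \<and> \<bar>y k - x k\<bar> < d) \<and>
    (\<forall>c. (\<forall>k\<in>K. c k \<in> \<rat>) \<longrightarrow> (\<Sum>k\<in>K. c k * x k) \<in> \<rat> \<longrightarrow> (\<Sum>k\<in>K. c k * y k) = (\<Sum>k\<in>K. c k * x k))"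
  using assms
proof (induction K arbitrary: d rule: finite_induct)
  case (insert i K)
  show ?case
  proof (cases "\<exists>c. (\<forall>k\<in>K. c k \<in> \<rat>) \<and> x i - (\<Sum>k\<in>K. c k * x k) \<in> \<rat>")
    case True
    then obtain c where c: "\<forall>k\<in>K. c k \<in> \<rat>" "x i - (\<Sum>k\<in>K. c k * x k) \<in> \<rat>" by blast
    \<comment> \<open>The forced value multiplies the errors of the others by at most the sum of
      \<open>\<bar>c k\<bar>\<close>, so they are approximated within \<open>d / C\<close>.\<close>
    define C where "C = 1 + (\<Sum>k\<in>K. \<bar>c k\<bar>)"
    have "C \<ge> 1" by (simp add: C_def sum_nonneg)
    then obtain y where y: "\<And>k. k \<in> K \<Longrightarrow> y k \<in> \<rat>" "\<And>k. k \<in> K \<Longrightarrow> \<bar>y k - x k\<bar> < d / C"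
      and rel: "\<And>c. \<forall>k\<in>K. c k \<in> \<rat> \<Longrightarrow> (\<Sum>k\<in>K. c k * x k) \<in> \<rat> \<Longrightarrow>
        (\<Sum>k\<in>K. c k * y k) = (\<Sum>k\<in>K. c k * x k)"
      using insert.IH[of "d / C"] insert.prems by auto
    define yi where "yi = x i + (\<Sum>k\<in>K. c k * (y k - x k))"
    have yi: "yi = x i - (\<Sum>k\<in>K. c k * x k) + (\<Sum>k\<in>K. c k * y k)"
      by (simp add: yi_def algebra_simps sum_subtractf)
    define z where "z = y(i := yi)"
    have zK: "z k = y k" if "k \<in> K" for k using that insert.hyps by (auto simp: z_def)
    have "(\<Sum>k\<in>K. c k * y k) \<in> \<rat>" using c y by (intro Rats_sum Rats_mult) auto
    then have "yi \<in> \<rat>" using c unfolding yi by (intro Rats_add) auto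
    moreover have "\<bar>yi - x i\<bar> < d"
    proof -
      have "\<bar>yi - x i\<bar> \<le> (\<Sum>k\<in>K. \<bar>c k * (y k - x k)\<bar>)"
        by (simp add: yi_def sum_abs)
      also have "\<dots> \<le> (\<Sum>k\<in>K. \<bar>c k\<bar> * (d / C))"
        unfolding abs_mult by (intro sum_mono mult_left_mono) (auto intro: less_imp_le y)
      also have "\<dots> = (C - 1) * (d / C)" unfolding C_def by (simp only: sum_distrib_right[symmetric]) simp
      also have "\<dots> < d" using \<open>C \<ge> 1\<close> insert.prems by (simp add: field_simps)
      finally show ?thesis .
    qed
    moreover have "\<bar>y k - x k\<bar> < d" if "k \<in> K" for k
    proof -
      have "d / C \<le> d" using \<open>C \<ge> 1\<close> insert.prems by (simp add: field_simps)
      then show ?thesis using y(2)[OF that] by linarith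
    qed
    ultimately have "\<forall>k\<in>insert i K. z k \<in> \<rat> \<and> \<bar>z k - x k\<bar> < d"
      using y zK by (auto simp: z_def)
    moreover have "(\<Sum>k\<in>insert i K. e k * z k) = (\<Sum>k\<in>insert i K. e k * x k)"
      if e: "\<forall>k\<in>insert i K. e k \<in> \<rat>" "(\<Sum>k\<in>insert i K. e k * x k) \<in> \<rat>" for e
    proof -
      define f where "f k = e k + e i * c k" for k
      have f: "(\<Sum>k\<in>K. f k * u k) = (\<Sum>k\<in>K. e k * u k) + e i * (\<Sum>k\<in>K. c k * u k)" for u
        by (simp add: f_def algebra_simps sum.distrib sum_distrib_left)
      have "(\<Sum>k\<in>K. f k * x k) = (\<Sum>k\<in>insert i K. e k * x k) - e i * (x i - (\<Sum>k\<in>K. c k * x k))"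
        using insert.hyps by (simp add: f algebra_simps)
      also have "\<dots> \<in> \<rat>" by (rule Rats_diff[OF e(2) Rats_mult[OF _ c(2)]]) (use e in auto)
      finally have "(\<Sum>k\<in>K. f k * y k) = (\<Sum>k\<in>K. f k * x k)"
        using e c by (intro rel) (auto simp: f_def)
      moreover have "(\<Sum>k\<in>K. e k * z k) = (\<Sum>k\<in>K. e k * y k)"
        by (intro sum.cong) (auto simp: zK)
      ultimately show ?thesis using insert.hyps
        by (simp add: f z_def yi algebra_simps)
    qed
    ultimately show ?thesis by blast
  next
    case False
    obtain y where y: "\<And>k. k \<in> K \<Longrightarrow> y k \<in> \<rat> \<and> \<bar>y k - x k\<bar> < d"
      and rel: "\<And>c. \<forall>k\<in>K. c k \<in> \<rat> \<Longrightarrow> (\<Sum>k\<in>K. c k * x k) \<in> \<rat> \<Longrightarrow>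
        (\<Sum>k\<in>K. c k * y k) = (\<Sum>k\<in>K. c k * x k)"
      using insert.IH[of d] insert.prems by auto
    obtain q where q: "q \<in> \<rat>" "\<bar>q - x i\<bar> < d" using Rats_approx insert.prems by blast
    define z where "z = y(i := q)"
    have zK: "z k = y k" if "k \<in> K" for k using that insert.hyps by (auto simp: z_def)
    have "(\<Sum>k\<in>insert i K. e k * z k) = (\<Sum>k\<in>insert i K. e k * x k)"
      if e: "\<forall>k\<in>insert i K. e k \<in> \<rat>" "(\<Sum>k\<in>insert i K. e k * x k) \<in> \<rat>" for e
    proof -
      \<comment> \<open>Dividing by a nonzero \<open>e i\<close> would express \<open>x i\<close>
        through the others, against the case assumption.\<close>
      have "e i = 0"
      proof (rule ccontr)
        assume "e i \<noteq> 0"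
        then have "x i - (\<Sum>k\<in>K. - (e k / e i) * x k) = (\<Sum>k\<in>insert i K. e k * x k) / e i"
          using insert.hyps by (simp add: add_divide_distrib sum_negf sum_divide_distrib)
        also have "\<dots> \<in> \<rat>" using e by (intro Rats_divide) auto
        finally show False using False e
          by (auto dest!: spec[of _ "\<lambda>k. - (e k / e i)"])
      qed
      moreover have "(\<Sum>k\<in>K. e k * z k) = (\<Sum>k\<in>K. e k * y k)"
        by (intro sum.cong) (auto simp: zK)
      ultimately show ?thesis using insert.hyps e rel[of e] by simp
    qed
    moreover have "\<forall>k\<in>insert i K. z k \<in> \<rat> \<and> \<bar>z k - x k\<bar> < d"
      using y zK q by (auto simp: z_def)
    ultimately show ?thesis by blast
  qed
qed auto

text \<open>Membership of \<open>v\<close> in a hull is a system of linear equations with rational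
  coefficients in the coordinates of \<open>v\<close> and the convex coefficients, so approximating
  both at once keeps it; non-membership is an open condition.\<close>

lemma rational_point_same_polytopes:
  fixes v :: "real^'n" and T :: "'j \<Rightarrow> (real^'n) set"
  assumes "finite J" and T: "\<And>j. j \<in> J \<Longrightarrow> finite (T j)"
    and rat: "\<And>j s. \<lbrakk>j \<in> J; s \<in> T j\<rbrakk> \<Longrightarrow> rational_vec s" and "0 < e"
  shows "\<exists>v'. rational_vec v' \<and> dist v v' < e \<and>
    (\<forall>j\<in>J. v' \<in> convex hull (T j) \<longleftrightarrow> v \<in> convex hull (T j))"
proof -
  define J1 where "J1 = {j\<in>J. v \<in> convex hull (T j)}"
  have "\<forall>j\<in>J1. \<exists>u. (\<forall>s\<in>T j. 0 \<le> u s) \<and> sum u (T j) = 1 \<and> (\<Sum>s\<in>T j. u s *\<^sub>R s) = v"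
    using T by (auto simp: J1_def convex_hull_finite)
  from bchoice[OF this] obtain u where u: "\<And>j s. \<lbrakk>j \<in> J1; s \<in> T j\<rbrakk> \<Longrightarrow> 0 \<le> u j s" "\<And>j. j \<in> J1 \<Longrightarrow> sum (u j) (T j) = 1"
    "\<And>j. j \<in> J1 \<Longrightarrow> (\<Sum>s\<in>T j. u j s *\<^sub>R s) = v"
    by blast
  \<comment> \<open>The indices \<open>Inl i\<close> stand for the coordinates of \<open>v\<close>,
    the indices \<open>Inr (j, s)\<close> for its convex coefficients in the hull of
    \<open>T j\<close>.\<close>
  define K :: "('n + 'j \<times> (real^'n)) set" where "K = range Inl \<union> Inr ` (SIGMA j:J1. T j)"
  define x where "x = case_sum (vec_nth v) (\<lambda>(j, s). u j s)"
  have "finite K" using \<open>finite J\<close> T by (auto simp: K_def J1_def intro!: finite_imageI finite_SigmaI)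
  define X where "X = {x k |k. k \<in> K \<and> 0 < x k}"
  have "finite X" using \<open>finite K\<close> by (simp add: X_def)
  have "closed (\<Union>j\<in>J - J1. convex hull (T j))"
    using \<open>finite J\<close> T
    by (intro closed_UN) (auto intro!: compact_imp_closed[OF compact_convex_hull[OF finite_imp_compact]])
  moreover have "v \<notin> (\<Union>j\<in>J - J1. convex hull (T j))" by (auto simp: J1_def)
  ultimately obtain r where "r > 0" and r: "ball v r \<subseteq> - (\<Union>j\<in>J - J1. convex hull (T j))"
    by (meson ComplI open_Compl open_contains_ball)
  \<comment> \<open>At most the smallest positive entry, so no positive coefficient becomes
    negative; the division by \<open>CARD('n)\<close> bounds the total deviation of the coordinates
    by \<open>min e r\<close>.\<close>
  define d where "d = Min (insert (min e r / CARD('n)) X)"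
  have "d > 0" using \<open>finite X\<close> \<open>r > 0\<close> \<open>e > 0\<close> by (auto simp: d_def X_def)
  have "d \<le> min e r / CARD('n)" and dX: "\<And>k. k \<in> K \<Longrightarrow> 0 < x k \<Longrightarrow> d \<le> x k"
    using \<open>finite X\<close> by (auto simp: d_def X_def intro!: Min_le)
  obtain y where y: "\<And>k. k \<in> K \<Longrightarrow> y k \<in> \<rat>" "\<And>k. k \<in> K \<Longrightarrow> \<bar>y k - x k\<bar> < d"
    and rel: "\<And>c. \<forall>k\<in>K. c k \<in> \<rat> \<Longrightarrow> (\<Sum>k\<in>K. c k * x k) \<in> \<rat> \<Longrightarrow>
      (\<Sum>k\<in>K. c k * y k) = (\<Sum>k\<in>K. c k * x k)"
    using rational_approx_relations[OF \<open>finite K\<close> \<open>d > 0\<close>, of x] by blast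
  have rel_on: "(\<Sum>k\<in>A. c k * y k) = (\<Sum>k\<in>A. c k * x k)"
    if "A \<subseteq> K" "\<forall>k\<in>A. c k \<in> \<rat>" "(\<Sum>k\<in>A. c k * x k) \<in> \<rat>" for A c
  proof -
    have *: "(\<Sum>k\<in>K. (if k \<in> A then c k else 0) * f k) = (\<Sum>k\<in>A. c k * f k)" for f
      using \<open>A \<subseteq> K\<close> \<open>finite K\<close> by (intro sum.mono_neutral_cong_right) auto
    show ?thesis using rel[of "\<lambda>k. if k \<in> A then c k else 0"] that(2,3) by (simp add: *)
  qed
  define v' where "v' = (\<chi> i. y (Inl i))"
  have "rational_vec v'" using y by (simp add: v'_def rational_vec_def K_def)
  have "dist v v' < CARD('n) * d"
  proof -
    have "dist v v' \<le> (\<Sum>i\<in>UNIV. \<bar>v $ i - v' $ i\<bar>)"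
      using norm_le_l1_cart[of "v - v'"] by (simp add: dist_norm)
    also have "\<dots> < (\<Sum>i\<in>(UNIV::'n set). d)"
    proof (intro sum_strict_mono)
      fix i :: 'n
      have "\<bar>y (Inl i) - v $ i\<bar> < d" using y(2)[of "Inl i"] by (simp add: K_def x_def)
      then show "\<bar>v $ i - v' $ i\<bar> < d" by (simp add: v'_def abs_minus_commute)
    qed auto
    finally show ?thesis by simp
  qed
  also have "\<dots> \<le> min e r"
    using \<open>d \<le> min e r / CARD('n)\<close> by (simp add: field_simps)
  finally have dist: "dist v v' < e" "dist v v' < r" by auto
  moreover have "v' \<in> convex hull (T j)" if "j \<in> J1" for j
  proof -
    have jJ: "j \<in> J" using that by (simp add: J1_def)
    have inK: "Inr (j, s) \<in> K" if "s \<in> T j" for s using that \<open>j \<in> J1\<close> by (auto simp: K_def)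
    have inj: "inj_on (\<lambda>s. Inr (j, s) :: 'n + 'j \<times> (real^'n)) (T j)" by (auto intro: inj_onI)
    have "0 \<le> y (Inr (j, s))" if "s \<in> T j" for s
    proof (cases "u j s = 0")
      \<comment> \<open>A vanishing coefficient stays zero, since \<open>u j s = 0\<close> is itself
        a rational relation.\<close>
      case True
      then show ?thesis
        using rel_on[of "{Inr (j, s)}" "\<lambda>_. 1"] inK[OF that] by (simp add: x_def)
    next
      case False
      then have "d \<le> u j s" using dX[OF inK[OF that]] u(1)[OF \<open>j \<in> J1\<close> that] by (simp add: x_def)
      then show ?thesis using y(2)[OF inK[OF that]] by (simp add: x_def)
    qed
    moreover have "(\<Sum>s\<in>T j. y (Inr (j, s))) = 1"
      using rel_on[of "(\<lambda>s. Inr (j, s)) ` T j" "\<lambda>_. 1"] u(2)[OF that] inK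
      by (simp add: sum.reindex[OF inj] x_def image_subset_iff)
    moreover have "(\<Sum>s\<in>T j. y (Inr (j, s)) *\<^sub>R s) = v'"
    proof (rule vec_eq_iff[THEN iffD2], rule allI)
      fix i
      have ui: "(\<Sum>s\<in>T j. s $ i * u j s) = v $ i"
        using arg_cong[OF u(3)[OF that], of "\<lambda>w. w $ i"] by (simp add: mult.commute)
      define c where "c = case_sum (\<lambda>_::'n. -1) (\<lambda>(j::'j, s::real^'n). s $ i)"
      define A where "A = insert (Inl i) ((\<lambda>s. Inr (j, s)) ` T j)"
      have A: "(\<Sum>k\<in>A. c k * f k) = (\<Sum>s\<in>T j. s $ i * f (Inr (j, s))) - f (Inl i)" for f :: "_ \<Rightarrow> real"
        unfolding A_def using T[OF jJ]
        by (subst sum.insert) (auto simp: sum.reindex[OF inj] c_def)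
      have "(\<Sum>k\<in>A. c k * y k) = (\<Sum>k\<in>A. c k * x k)"
      proof (rule rel_on)
        show "A \<subseteq> K" using inK by (auto simp: A_def K_def)
        show "\<forall>k\<in>A. c k \<in> \<rat>" using rat[OF jJ] by (auto simp: A_def c_def rational_vec_def)
        show "(\<Sum>k\<in>A. c k * x k) \<in> \<rat>" unfolding A by (simp add: x_def ui)
      qed
      then show "(\<Sum>s\<in>T j. y (Inr (j, s)) *\<^sub>R s) $ i = v' $ i"
        unfolding A by (simp add: x_def ui v'_def mult.commute)
    qed
    ultimately show ?thesis
      using T[OF jJ] by (auto simp: convex_hull_finite intro!: exI[of _ "\<lambda>s. y (Inr (j, s))"])
  qed
  moreover have "v' \<notin> convex hull (T j)" if "j \<in> J - J1" for j
    using r dist(2) that by (auto simp: subset_iff)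
  ultimately show ?thesis using \<open>rational_vec v'\<close>
    by (intro exI[of _ v']) (auto simp: J1_def)
qed

text \<open>The weights are the Lagrange basis polynomials evaluated at \<open>x\<close>; they
  depend on the nodes and \<open>x\<close> only, so one choice serves all polynomials of degree
  below \<open>n\<close>.\<close>

lemma lagrange_extrapolation:
  fixes t :: "nat \<Rightarrow> real"
  assumes "inj_on t {..<n}"
  shows "\<exists>l. \<forall>p. degree p < n \<longrightarrow> poly p x = (\<Sum>j<n. l j * poly p (t j))"
proof (intro exI allI impI)
  define L where "L j = smult (1 / (\<Prod>i\<in>{..<n} - {j}. t j - t i)) (\<Prod>i\<in>{..<n} - {j}. [:- t i, 1:])" for j
  have degL: "degree (L j) < n" if "j < n" for j
  proof -
    have "degree (L j) \<le> (\<Sum>i\<in>{..<n} - {j}. (degree \<circ> (\<lambda>i. [:- t i, 1:])) i)"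
      unfolding L_def by (intro order.trans[OF degree_smult_le] degree_prod_sum_le) simp
    also have "\<dots> < n" using that by simp
    finally show ?thesis .
  qed
  have polyL: "poly (L j) (t k) = of_bool (j = k)" if "j < n" "k < n" for j k
  proof (cases "j = k")
    case True
    have "(\<Prod>i\<in>{..<n} - {k}. t k - t i) \<noteq> 0"
      using that assms by (auto simp: inj_on_def)
    then show ?thesis using True by (simp add: L_def poly_prod)
  next
    case False
    then have "(\<Prod>i\<in>{..<n} - {j}. t k - t i) = 0"
      using that by (intro prod_zero) auto
    then show ?thesis using False by (simp add: L_def poly_prod)
  qed
  fix p :: "real poly" assume "degree p < n"
  define q where "q = (\<Sum>j<n. smult (poly p (t j)) (L j))"
  have "p = q"
  proof (rule poly_eqI_degree[where A = "t ` {..<n}"])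
    fix z assume "z \<in> t ` {..<n}"
    then obtain k where k: "k < n" "z = t k" by auto
    have "poly q z = (\<Sum>j<n. poly p (t j) * of_bool (j = k))"
      unfolding q_def k poly_sum poly_smult using k by (intro sum.cong) (auto simp: polyL)
    then show "poly p z = poly q z" using k by (simp add: of_bool_def if_distrib sum.delta cong: if_cong)
  next
    show "card (t ` {..<n}) > degree p" using assms \<open>degree p < n\<close> by (simp add: card_image)
    have "degree q < n"
      unfolding q_def using \<open>degree p < n\<close>
      by (intro degree_sum_less) (auto intro: le_less_trans[OF degree_smult_le] degL)
    then show "card (t ` {..<n}) > degree q" using assms by (simp add: card_image)
  qed
  then have "poly p x = poly q x" by simp
  then show "poly p x = (\<Sum>j<n. poly (L j) x * poly p (t j))"
    by (simp add: q_def poly_sum mult.commute)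
qed

lemma poly_eqI_inj:
  fixes p q :: "real poly" and f :: "nat \<Rightarrow> real"
  assumes "inj f" "\<And>r. poly p (f r) = poly q (f r)"
  shows "p = q"
proof (rule ccontr)
  assume "p \<noteq> q"
  then have "finite {x. poly (p - q) x = 0}" by (intro poly_roots_finite) simp
  moreover have "range f \<subseteq> {x. poly (p - q) x = 0}" using assms(2) by auto
  ultimately show False using assms(1) finite_subset range_inj_infinite by blast
qed

section \<open>Symmetric quasi-polynomials\<close>

lemma ehr_translate:
  "ehr ((\<lambda>x. x + v) ` P) t = dilate_count P (real t) (real t *\<^sub>R v)"
proof -
  have "(\<lambda>x. real t *\<^sub>R x) ` (\<lambda>x. x + v) ` P \<inter> lattice_points
      = {z\<in>lattice_points. \<exists>x\<in>P. z = real t *\<^sub>R x + real t *\<^sub>R v}"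
    by (auto simp: image_iff scaleR_add_right)
  then show ?thesis by (simp add: ehr_def dilate_count_def)
qed

section \<open>Symmetry for translates of a half-integral polytope\<close>

lemma dilate_count_cong_lattice:
  assumes "c - d \<in> lattice_points"
  shows "dilate_count P r c = dilate_count P r d"
proof -
  have "d + (c - d) = c" by simp
  then show ?thesis using dilate_count_shift[OF assms, of P r d] by metis
qed

text \<open>The constituents of \<open>P + v\<close> for \<open>k\<close> and \<open>-k\<close> count \<open>tP + kv\<close> and \<open>tP - kv\<close> for \<open>t\<close> of the
  same parity, and these agree by central symmetry. They are chosen by \<open>Eps\<close> from the same predicate,
  which spares a uniqueness argument.\<close>
lemma half_integral_imp_ehr_symmetric:
  fixes P :: "(real^'n) set"
  assumes "finite S" "S \<noteq> {}" "S \<subseteq> lattice_points"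
    and hull: "convex hull S = (\<lambda>x. 2 *\<^sub>R x) ` P"
    and sym: "uminus ` P = P" and "rational_vec v"
  shows "ehr_symmetric ((\<lambda>x. x + v) ` P)"
proof -
  obtain M :: nat where M: "0 < M" "real M *\<^sub>R v \<in> lattice_points"
    using common_denominator_vec[of "{v}"] assms by auto
  \<comment> \<open>The residue of \<open>t\<close> modulo \<open>N\<close> determines its parity,
    and also the vector \<open>t v\<close> up to a lattice vector.\<close>
  define N where "N = 2 * M"
  have "0 < N" using M by (simp add: N_def)
  define good where "good k p \<longleftrightarrow> (\<forall>t. t mod 2 = k mod 2 \<longrightarrow>
    real (dilate_count P (real t) (real k *\<^sub>R v)) = poly p (real t))" for k :: nat and p
  define p where "p k = Eps (good k)" for k
  have good: "good k (p k)" for k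
  proof -
    have "\<exists>q. good k q"
      unfolding good_def using ehrhart_constituent[of S 2 P k "real k *\<^sub>R v"] assms by auto
    then show ?thesis unfolding p_def by (rule someI_ex)
  qed
  have NL: "(real_of_int i * real N) *\<^sub>R v \<in> lattice_points" for i
    using lattice_points_scale[OF _ M(2), of "real_of_int (2 * i)"] by (simp add: N_def mult_ac)
  have "real (ehr ((\<lambda>x. x + v) ` P) t) = poly (p (t mod N)) (real t)" for t
  proof -
    have "real t *\<^sub>R v - real (t mod N) *\<^sub>R v = (real_of_int (int (t div N)) * real N) *\<^sub>R v"
    proof -
      have "real t - real (t mod N) = real (t div N) * real N"
        by (metis add_diff_cancel_right' div_mult_mod_eq of_nat_add of_nat_mult)
      then show ?thesis by (simp flip: scaleR_diff_left)
    qed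
    then have "dilate_count P (real t) (real t *\<^sub>R v) = dilate_count P (real t) (real (t mod N) *\<^sub>R v)"
      using NL[of "int (t div N)"] by (intro dilate_count_cong_lattice) simp
    moreover have "t mod 2 = (t mod N) mod 2" by (simp add: N_def mod_mod_cancel)
    ultimately show ?thesis using good[of "t mod N"] by (simp add: ehr_translate good_def)
  qed
  moreover have "p k = p ((N - k) mod N)" if "k < N" for k
  proof (cases "k = 0")
    case False
    have "(N - k) mod 2 = k mod 2" using that by (simp add: N_def mod2_eq_if)
    moreover have "dilate_count P r (real (N - k) *\<^sub>R v) = dilate_count P r (real k *\<^sub>R v)" for r
    proof -
      \<comment> \<open>Modulo lattice vectors \<open>(N - k) v\<close> is \<open>- k v\<close>, so
        the central symmetry of \<open>P\<close> identifies the counts.\<close>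
      have "real (N - k) *\<^sub>R v - - (real k *\<^sub>R v) = (real_of_int 1 * real N) *\<^sub>R v"
        using that by (simp add: of_nat_diff algebra_simps)
      then have "dilate_count P r (real (N - k) *\<^sub>R v) = dilate_count P r (- (real k *\<^sub>R v))"
        using NL[of 1] by (intro dilate_count_cong_lattice) simp
      then show ?thesis using dilate_count_uminus[OF sym] by simp
    qed
    ultimately have "good (N - k) = good k" by (auto simp: good_def fun_eq_iff)
    then show ?thesis using False that by (simp add: p_def)
  qed simp
  ultimately show ?thesis unfolding ehr_symmetric_def using \<open>0 < N\<close> by blast
qed

text \<open>For \<open>t\<close> congruent to 1 modulo a suitable \<open>K\<close>, translation by
  \<open>t v\<close> amounts to translation by \<open>v\<close>; for \<open>t\<close> congruent to
  -1 it amounts to \<open>- v\<close>, which gives the same count by central symmetry. So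
  \<open>p\<close> and \<open>q\<close> are the constituents of the Ehrhart function for 1 and -1,
  which symmetry equates.\<close>

lemma ehr_symmetric_constituents_eq:
  fixes P :: "(real^'n) set"
  assumes "0 < D" and sym: "uminus ` P = P" and "rational_vec v"
    and "ehr_symmetric ((\<lambda>x. x + v) ` P)"
    and p: "\<And>t. t mod D = 1 mod D \<Longrightarrow> real (dilate_count P (real t) v) = poly p (real t)"
    and q: "\<And>t. t mod D = D - 1 \<Longrightarrow> real (dilate_count P (real t) v) = poly q (real t)"
  shows "p = q"
proof -
  obtain N c where N: "0 < N" "\<And>t. real (ehr ((\<lambda>x. x + v) ` P) t) = poly (c (t mod N)) (real t)"
    "\<And>k. k < N \<Longrightarrow> c k = c ((N - k) mod N)"
    using assms(4) unfolding ehr_symmetric_def by blast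
  obtain M :: nat where M: "0 < M" "real M *\<^sub>R v \<in> lattice_points"
    using common_denominator_vec[of "{v}"] assms by auto
  \<comment> \<open>A common multiple of the period \<open>N\<close>, the modulus \<open>D\<close>
    and a denominator \<open>M\<close> of \<open>v\<close>.\<close>
  define K where "K = N * M * D"
  have "0 < K" using N(1) M(1) \<open>0 < D\<close> by (simp add: K_def)
  have KL: "real (K * r) *\<^sub>R v \<in> lattice_points" for r
    using lattice_points_scale[OF _ M(2), of "real (N * D * r)"] by (simp add: K_def mult_ac)
  have plus: "poly p (real (1 + K * r)) = poly (c (1 mod N)) (real (1 + K * r))" for r
  proof -
    let ?t = "1 + K * r"
    have "K * r = D * (N * M * r)" "K * r = N * (M * D * r)" by (simp_all add: K_def)
    then have "?t mod D = 1 mod D" and tN: "?t mod N = 1 mod N"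
      by (metis mod_mult_self2)+
    have "real ?t *\<^sub>R v - v \<in> lattice_points"
      using KL[of r] by (simp add: algebra_simps)
    then have "ehr ((\<lambda>x. x + v) ` P) ?t = dilate_count P (real ?t) v"
      unfolding ehr_translate by (rule dilate_count_cong_lattice)
    then show ?thesis using p[OF \<open>?t mod D = 1 mod D\<close>] N(2)[of ?t] tN by simp
  qed
  \<comment> \<open>The factor \<open>r + 1\<close> keeps the subtraction from truncating at
    zero.\<close>
  have minus_mod: "(K * (r + 1) - 1) mod n = n - 1" if dvd: "n dvd K" and "0 < n" for n r
  proof -
    obtain m where m: "K = n * m" using dvd by (rule dvdE)
    then have "0 < m * (r + 1)" using \<open>0 < K\<close> by simp
    then obtain y where y: "m * (r + 1) = Suc y" by (metis Suc_pred)
    have "K * (r + 1) - 1 = n * (m * (r + 1)) - 1" by (simp only: m mult.assoc)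
    also have "\<dots> = n * y + (n - 1)" unfolding y using \<open>0 < n\<close> by simp
    finally have "(K * (r + 1) - 1) mod n = (n * y + (n - 1)) mod n" by (rule arg_cong)
    also have "\<dots> = (n - 1) mod n" by (rule mod_mult_self4)
    also have "\<dots> = n - 1" using \<open>0 < n\<close> by simp
    finally show ?thesis .
  qed
  have minus: "poly q (real (K * (r + 1) - 1)) = poly (c (1 mod N)) (real (K * (r + 1) - 1))" for r
  proof -
    let ?t = "K * (r + 1) - 1"
    have "?t mod D = D - 1" "?t mod N = N - 1"
      using minus_mod[of D r] minus_mod[of N r] N(1) assms(1) by (simp_all add: K_def)
    moreover have "c (N - 1) = c (1 mod N)"
    proof (cases "N = 1")
      case False
      then show ?thesis using N(1) N(3)[of 1] by simp
    qed simp
    moreover have "real ?t *\<^sub>R v - (- v) \<in> lattice_points"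
    proof -
      have "real ?t = real (K * (r + 1)) - 1" using \<open>0 < K\<close> by (simp add: of_nat_diff Suc_le_eq)
      then show ?thesis using KL[of "r + 1"] by (simp add: scaleR_diff_left)
    qed
    then have "ehr ((\<lambda>x. x + v) ` P) ?t = dilate_count P (real ?t) (- v)"
      unfolding ehr_translate by (rule dilate_count_cong_lattice)
    ultimately show ?thesis
      using q[of ?t] N(2)[of ?t] dilate_count_uminus[OF sym] by simp
  qed
  have "p = c (1 mod N)"
    by (rule poly_eqI_inj[of "\<lambda>r. real (1 + K * r)"]) (use \<open>0 < K\<close> plus in \<open>auto intro!: injI\<close>)
  moreover have "q = c (1 mod N)"
  proof (rule poly_eqI_inj[of "\<lambda>r. real (K * (r + 1) - 1)"])
    have "K * (r + 1) - 1 \<noteq> K * (s + 1) - 1" if "r < s" for r s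
    proof -
      have "1 \<le> K * (r + 1)" "K * (r + 1) < K * (s + 1)" using \<open>0 < K\<close> that by simp_all
      then show ?thesis by linarith
    qed
    then show "inj (\<lambda>r. real (K * (r + 1) - 1))"
      by (auto intro!: linorder_injI)
  qed (rule minus)
  ultimately show ?thesis by simp
qed

text \<open>By rational approximation, the relation between the counts extends from rational to real
  translation vectors, where it is a relation between indicator functions of translates of dilates.\<close>
lemma indicator_relation_of_dilate_counts:
  fixes P :: "(real^'n) set"
  assumes "finite V" "\<And>x. x \<in> V \<Longrightarrow> rational_vec x" and P: "P = convex hull V"
    and "uminus ` P = P" and "finite I" and "open B" "bounded B"
    and rel: "\<And>v. rational_vec v \<Longrightarrow> (\<Sum>i\<in>I. b i * real (dilate_count P (real (t i)) v)) = 0"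
  obtains Z where "finite Z" "Z \<subseteq> lattice_points"
    "\<And>z i v. \<lbrakk>z \<in> lattice_points; i \<in> I; v \<in> B; v \<in> (\<lambda>y. z + real (t i) *\<^sub>R y) ` P\<rbrakk> \<Longrightarrow> z \<in> Z"
    "\<And>v. v \<in> B \<Longrightarrow> (\<Sum>j\<in>{j\<in>Z \<times> I. v \<in> (\<lambda>y. fst j + real (t (snd j)) *\<^sub>R y) ` P}. b (snd j)) = 0"
proof -
  define C where "C j = (\<lambda>y. fst j + real (t (snd j)) *\<^sub>R y) ` P" for j
  define Y where "Y i = (\<lambda>(v, y). v - real (t i) *\<^sub>R y) ` (closure B \<times> P)" for i
  define Z where "Z = (\<Union>i\<in>I. Y i) \<inter> lattice_points"
  have "compact P" using assms by (simp add: compact_convex_hull finite_imp_compact)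
  have "compact (Y i)" for i
    unfolding Y_def case_prod_beta using \<open>compact P\<close> \<open>bounded B\<close>
    by (intro compact_continuous_image continuous_intros compact_Times) (auto simp: compact_closure)
  then have "finite Z"
    unfolding Z_def using \<open>finite I\<close> by (intro finite_lattice_points bounded_UN) (auto simp: compact_imp_bounded)
  moreover have ZI: "z \<in> Z" if "z \<in> lattice_points" "i \<in> I" "v \<in> B" and v: "v \<in> C (z, i)" for z i v
  proof -
    obtain y where "y \<in> P" "v = z + real (t i) *\<^sub>R y" using v by (auto simp: C_def)
    then have "z \<in> Y i" unfolding Y_def using that closure_subset[of B]
      by (intro image_eqI[of _ _ "(v, y)"]) auto
    then show ?thesis using that by (auto simp: Z_def)
  qed
  moreover have count: "(\<Sum>j\<in>{j\<in>Z \<times> I. v \<in> C j}. b (snd j))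
      = (\<Sum>i\<in>I. b i * real (dilate_count P (real (t i)) v))" if "v \<in> B" for v
  proof -
    \<comment> \<open>Central symmetry turns \<open>z = t x + v\<close> into
      \<open>v = z + t (- x)\<close>, so \<open>dilate_count\<close> counts the sets that contain
      \<open>v\<close>.\<close>
    have neg: "- x \<in> P" if "x \<in> P" for x using assms(4) that by blast
    have "(\<Sum>j\<in>{j\<in>Z \<times> I. v \<in> C j}. b (snd j)) = (\<Sum>j\<in>Z \<times> I. if v \<in> C j then b (snd j) else 0)"
      using \<open>finite Z\<close> \<open>finite I\<close> by (intro sum.inter_filter) auto
    also have "\<dots> = (\<Sum>z\<in>Z. \<Sum>i\<in>I. if v \<in> C (z, i) then b i else 0)"
      by (subst sum.cartesian_product) (auto intro!: sum.cong)
    also have "\<dots> = (\<Sum>i\<in>I. \<Sum>z\<in>Z. if v \<in> C (z, i) then b i else 0)"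
      by (rule sum.swap)
    also have "\<dots> = (\<Sum>i\<in>I. b i * real (dilate_count P (real (t i)) v))"
    proof (rule sum.cong)
      fix i assume "i \<in> I"
      have "(\<exists>x\<in>P. z = real (t i) *\<^sub>R x + v) \<longleftrightarrow> v \<in> C (z, i)" for z
      proof
        assume "\<exists>x\<in>P. z = real (t i) *\<^sub>R x + v"
        then obtain x where "x \<in> P" "z = real (t i) *\<^sub>R x + v" by blast
        then show "v \<in> C (z, i)" unfolding C_def by (intro image_eqI[of _ _ "- x"]) (auto simp: neg)
      next
        assume "v \<in> C (z, i)"
        then obtain x where "x \<in> P" "v = z + real (t i) *\<^sub>R x" by (auto simp: C_def)
        then show "\<exists>x\<in>P. z = real (t i) *\<^sub>R x + v" by (intro bexI[of _ "- x"]) (auto simp: neg)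
      qed
      moreover have "{z\<in>lattice_points. v \<in> C (z, i)} = {z\<in>Z. v \<in> C (z, i)}"
        using ZI \<open>i \<in> I\<close> \<open>v \<in> B\<close> by (auto simp: Z_def)
      ultimately have "dilate_count P (real (t i)) v = card {z\<in>Z. v \<in> C (z, i)}"
        by (simp add: dilate_count_def)
      then show "(\<Sum>z\<in>Z. if v \<in> C (z, i) then b i else 0) = b i * real (dilate_count P (real (t i)) v)"
        using \<open>finite Z\<close> by (simp add: sum.inter_filter[symmetric])
    qed simp
    finally show ?thesis .
  qed
  moreover have "(\<Sum>j\<in>{j\<in>Z \<times> I. v \<in> C j}. b (snd j)) = 0" if "v \<in> B" for v
  proof -
    define T where "T j = (\<lambda>y. fst j + real (t (snd j)) *\<^sub>R y) ` V" for j
    have CT: "C j = convex hull (T j)" for j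
      unfolding C_def T_def P by (rule convex_hull_affinity[symmetric])
    obtain e where "e > 0" "ball v e \<subseteq> B"
      using \<open>open B\<close> \<open>v \<in> B\<close> by (meson open_contains_ball)
    \<comment> \<open>A rational point near \<open>v\<close> lies in the same sets
      \<open>C j\<close>, so the relation there carries over to \<open>v\<close>.\<close>
    have "\<exists>v'. rational_vec v' \<and> dist v v' < e \<and>
      (\<forall>j\<in>Z \<times> I. v' \<in> convex hull (T j) \<longleftrightarrow> v \<in> convex hull (T j))"
    proof (rule rational_point_same_polytopes)
      fix j s assume "j \<in> Z \<times> I" "s \<in> T j"
      then show "rational_vec s" using assms(2)
        by (auto simp: T_def Z_def rational_vec_def lattice_points_def Ints_subset_Rats[THEN subsetD])
    qed (use \<open>finite Z\<close> \<open>finite I\<close> \<open>finite V\<close> \<open>e > 0\<close> in \<open>auto simp: T_def\<close>)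
    then obtain v' where v': "rational_vec v'" "dist v v' < e" "\<forall>j\<in>Z \<times> I. v' \<in> C j \<longleftrightarrow> v \<in> C j"
      unfolding CT by blast
    then have "{j\<in>Z \<times> I. v \<in> C j} = {j\<in>Z \<times> I. v' \<in> C j}" by blast
    moreover have "v' \<in> B" using v'(2) \<open>ball v e \<subseteq> B\<close> by auto
    ultimately show ?thesis using count[OF \<open>v' \<in> B\<close>] rel[OF v'(1)] by simp
  qed
  ultimately show ?thesis
    using that[of Z] by (auto simp: Z_def C_def)
qed

text \<open>Compares the Euler characteristics of the parts of the \<open>C j\<close> in the point \<open>w\<close> and in a small
  flat piece of the hyperplane \<open>a \<bullet> (x - w) = \<eta>\<close> just above \<open>w\<close>: they differ exactly for the \<open>C j\<close>
  that have \<open>w\<close> as a highest point.\<close>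
lemma euler_relation_top:
  fixes C :: "'j \<Rightarrow> (real^'n) set" and b :: "'j \<Rightarrow> real"
  assumes "finite J"
    and cpt: "\<And>j. j \<in> J \<Longrightarrow> compact (C j)"
    and cvx: "\<And>j. j \<in> J \<Longrightarrow> convex (C j)"
    and rel: "\<And>x. x \<in> ball w 1 \<Longrightarrow> (\<Sum>j\<in>{j\<in>J. x \<in> C j}. b j) = 0"
  shows "(\<Sum>j\<in>{j\<in>J. w \<in> C j \<and> (\<forall>x\<in>C j. a \<bullet> x \<le> a \<bullet> w)}. b j) = 0"
proof -
  have "closed (\<Union>j\<in>{j\<in>J. w \<notin> C j}. C j)"
    using \<open>finite J\<close> cpt by (intro closed_UN) (auto simp: compact_imp_closed)
  moreover have "w \<notin> (\<Union>j\<in>{j\<in>J. w \<notin> C j}. C j)" by auto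
  ultimately obtain r where "r > 0" and r: "ball w r \<subseteq> - (\<Union>j\<in>{j\<in>J. w \<notin> C j}. C j)"
    by (meson ComplI open_Compl open_contains_ball)
  \<comment> \<open>Within distance \<open>e\<close> of \<open>w\<close> every point satisfies
    \<open>rel\<close>, and only sets containing \<open>w\<close> are met.\<close>
  define e where "e = min r 1 / 2"
  have e: "0 < e" "e < r" "e < 1" using \<open>r > 0\<close> by (auto simp: e_def)
  define K where "K \<eta> = cball w e \<inter> {u. a \<bullet> u = a \<bullet> w + \<eta>}" for \<eta>
  have "\<forall>\<^sub>F \<eta> in at_right 0. \<forall>j\<in>{j\<in>J. w \<in> C j \<and> (\<exists>x\<in>C j. a \<bullet> w < a \<bullet> x)}. C j \<inter> K \<eta> \<noteq> {}"
  proof (intro eventually_ball_finite ballI)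
    fix j assume "j \<in> {j\<in>J. w \<in> C j \<and> (\<exists>x\<in>C j. a \<bullet> w < a \<bullet> x)}"
    then obtain x where j: "j \<in> J" "w \<in> C j" and x: "x \<in> C j" "a \<bullet> w < a \<bullet> x" by blast
    define h where "h = a \<bullet> x - a \<bullet> w"
    define n where "n = norm (x - w) + 1"
    have "h > 0" "n > 0" using x by (auto simp: h_def n_def intro: add_nonneg_pos)
    then have "\<forall>\<^sub>F \<eta> in at_right 0. \<eta> \<in> {0<..<min h (e * h / n)}"
      using e by (intro eventually_at_right_real) auto
    then show "\<forall>\<^sub>F \<eta> in at_right 0. C j \<inter> K \<eta> \<noteq> {}"
    proof eventually_elim
      case (elim \<eta>)
      then have \<eta>: "0 < \<eta>" "\<eta> < h" "\<eta> * n < e * h" using \<open>n > 0\<close> by (auto simp: field_simps)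
      \<comment> \<open>The point of the segment from \<open>w\<close> to \<open>x\<close> at height
        \<eta> above \<open>w\<close>; the bounds on \<eta> keep it on the segment and within
        \<open>e\<close> of \<open>w\<close>.\<close>
      define u where "u = (1 - \<eta> / h) *\<^sub>R w + (\<eta> / h) *\<^sub>R x"
      have u: "u = w + (\<eta> / h) *\<^sub>R (x - w)" by (simp add: u_def algebra_simps)
      have "u \<in> C j"
        using cvx[OF j(1)] j x \<eta> unfolding u_def convex_alt by simp
      moreover have "a \<bullet> u = a \<bullet> w + \<eta>"
        using \<open>h > 0\<close> by (simp add: u inner_add_right inner_diff_right flip: h_def)
      moreover have "dist w u \<le> e"
      proof -
        have "dist w u = \<eta> / h * norm (x - w)" using \<eta> by (simp add: u dist_norm)
        also have "\<dots> \<le> \<eta> / h * n" using \<eta> by (intro mult_left_mono) (auto simp: n_def)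
        also have "\<dots> \<le> e" using \<eta> by (simp add: field_simps)
        finally show ?thesis .
      qed
      ultimately show ?case by (auto simp: K_def)
    qed
  qed (use \<open>finite J\<close> in auto)
  moreover have "\<forall>\<^sub>F \<eta> in at_right (0::real). 0 < \<eta>" by (rule eventually_at_right_less)
  ultimately have "\<forall>\<^sub>F \<eta> in at_right 0. 0 < \<eta> \<and>
      (\<forall>j\<in>{j\<in>J. w \<in> C j \<and> (\<exists>x\<in>C j. a \<bullet> w < a \<bullet> x)}. C j \<inter> K \<eta> \<noteq> {})"
    by eventually_elim auto
  from eventually_happens'[OF trivial_limit_at_right_real this]
  obtain \<eta> where \<eta>: "0 < \<eta>"
    "\<And>j. \<lbrakk>j \<in> J; w \<in> C j; \<exists>x\<in>C j. a \<bullet> w < a \<bullet> x\<rbrakk> \<Longrightarrow> C j \<inter> K \<eta> \<noteq> {}"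
    by blast
  have "(\<Sum>j\<in>{j\<in>J. C j \<inter> K \<eta> \<noteq> {}}. b j) = 0"
  proof (rule euler_relation)
    have "compact (K \<eta>)" "convex (K \<eta>)"
      unfolding K_def
      by (auto intro!: compact_Int_closed convex_Int closed_hyperplane convex_hyperplane)
    then show "compact (C j \<inter> K \<eta>)" "convex (C j \<inter> K \<eta>)" if "j \<in> J" for j
      using cpt cvx that by (auto intro!: compact_Int convex_Int)
    show "(\<Sum>j\<in>{j\<in>J. x \<in> C j \<inter> K \<eta>}. b j) = 0" for x
    proof (cases "x \<in> K \<eta>")
      case True
      then have "x \<in> ball w 1" using e by (auto simp: K_def)
      then show ?thesis using rel[of x] True by simp
    qed simp
  qed fact
  \<comment> \<open>The sets meeting the flat piece are those that contain \<open>w\<close> and rise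
    above it; subtracting their relation from the one at \<open>w\<close> leaves the sets with top
    \<open>w\<close>.\<close>
  moreover have "{j\<in>J. C j \<inter> K \<eta> \<noteq> {}} = {j\<in>J. w \<in> C j \<and> (\<exists>x\<in>C j. a \<bullet> w < a \<bullet> x)}"
  proof -
    have "w \<in> C j \<and> (\<exists>x\<in>C j. a \<bullet> w < a \<bullet> x)" if j: "j \<in> J" "C j \<inter> K \<eta> \<noteq> {}" for j
    proof -
      obtain x where x: "x \<in> C j" "x \<in> K \<eta>" using j by blast
      then have "x \<in> ball w r" using e by (auto simp: K_def)
      then have "w \<in> C j" using r x j by blast
      then show ?thesis using x \<eta>(1) by (auto simp: K_def intro!: bexI[of _ x])
    qed
    then show ?thesis using \<eta>(2) by blast
  qed
  moreover have "(\<Sum>j\<in>{j\<in>J. w \<in> C j}. b j)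
    = (\<Sum>j\<in>{j\<in>J. w \<in> C j \<and> (\<exists>x\<in>C j. a \<bullet> w < a \<bullet> x)}. b j)
    + (\<Sum>j\<in>{j\<in>J. w \<in> C j \<and> (\<forall>x\<in>C j. a \<bullet> x \<le> a \<bullet> w)}. b j)" (is "_ = sum b ?A + sum b ?B")
  proof -
    have "{j\<in>J. w \<in> C j} = ?A \<union> ?B" "?A \<inter> ?B = {}"
      by (auto simp: not_le[symmetric])
    then show ?thesis using \<open>finite J\<close> by (simp add: sum.union_disjoint)
  qed
  moreover have "(\<Sum>j\<in>{j\<in>J. w \<in> C j}. b j) = 0" by (rule rel) simp
  ultimately show ?thesis by simp
qed

text \<open>Since \<open>w\<close> is the only point of \<open>P\<close> where \<open>a\<close> is
  maximal, \<open>z + tP\<close> has \<open>w\<close> as a highest point only if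
  \<open>w = z + tw\<close>. Unless \<open>2w\<close> is a lattice point, \<open>P\<close> itself is
  the only such set in the indicator relation, and its coefficient 1 cannot cancel.\<close>

lemma ehr_symmetric_imp_vertex_half_integral:
  fixes P :: "(real^'n) set"
  assumes V: "finite V" "\<And>x. x \<in> V \<Longrightarrow> rational_vec x" and P: "P = convex hull V"
    and sym: "uminus ` P = P"
    and ehr: "\<And>v. rational_vec v \<Longrightarrow> ehr_symmetric ((\<lambda>x. x + v) ` P)"
    and w: "w \<in> V" and top: "\<And>y. \<lbrakk>y \<in> P; y \<noteq> w\<rbrakk> \<Longrightarrow> a \<bullet> y < a \<bullet> w"
  shows "2 *\<^sub>R w \<in> lattice_points"
proof (rule ccontr)
  assume half: "2 *\<^sub>R w \<notin> lattice_points"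
  obtain D :: nat where D: "0 < D" "\<And>v. v \<in> V \<Longrightarrow> real D *\<^sub>R v \<in> lattice_points"
    using common_denominator_vec[OF V] by blast
  define S where "S = (\<lambda>x. real D *\<^sub>R x) ` V"
  define n where "n = card S"
  have S: "finite S" "S \<noteq> {}" "S \<subseteq> lattice_points" "convex hull S = (\<lambda>x. real D *\<^sub>R x) ` P"
    using V w D by (auto simp: S_def P convex_hull_scaling)
  have w_in: "w \<in> P" using w by (simp add: P hull_inc)
  \<comment> \<open>The extrapolation nodes, congruent to -1 modulo \<open>D\<close>; the offset 2
    keeps them positive even for \<open>D = 1\<close>.\<close>
  define s where "s j = D * (j + 2) - 1" for j
  have s_real: "real (s j) = real D * real (j + 2) - 1" for j
  proof -
    have "1 \<le> D * (j + 2)" using D by simp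
    then show ?thesis unfolding s_def by (simp only: of_nat_diff of_nat_mult of_nat_1)
  qed
  have s_pos: "0 < real (s j)" for j
  proof -
    have "1 * 2 \<le> real D * real (j + 2)" using D by (intro mult_mono) auto
    then show ?thesis unfolding s_real by linarith
  qed
  have s_mod: "s j mod D = D - 1" for j
  proof -
    have "s j = D * (j + 1) + (D - 1)" using D by (simp add: s_def)
    then have "s j mod D = (D - 1) mod D" by (simp only: mod_mult_self4)
    then show ?thesis using D(1) by simp
  qed
  have "inj_on (\<lambda>j. real (s j)) {..<n}"
    using D by (auto simp: inj_on_def s_real)
  from lagrange_extrapolation[OF this, of 1] obtain l where
    l: "\<And>p. degree p < n \<Longrightarrow> poly p 1 = (\<Sum>j<n. l j * poly p (real (s j)))" by blast
  \<comment> \<open>Index 0 stands for \<open>P\<close> itself, index \<open>Suc j\<close> for the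
    node \<open>s j\<close>; the coefficients \<open>b\<close> move the extrapolation formula to one
    side.\<close>
  define t where "t i = (case i of 0 \<Rightarrow> 1 | Suc j \<Rightarrow> s j)" for i
  define b where "b i = (case i of 0 \<Rightarrow> 1 | Suc j \<Rightarrow> - l j)" for i
  have t_pos: "0 < real (t i)" for i using s_pos by (simp add: t_def split: nat.split)
  have rel: "(\<Sum>i<Suc n. b i * real (dilate_count P (real (t i)) v)) = 0" if "rational_vec v" for v
  proof -
    obtain p where p: "degree p < n"
      "\<And>t. t mod D = 1 mod D \<Longrightarrow> real (dilate_count P (real t) v) = poly p (real t)"
      using ehrhart_constituent[OF S D(1), of 1 v] by (auto simp: n_def)
    obtain q where q: "degree q < n"
      "\<And>t. t mod D = D - 1 \<Longrightarrow> real (dilate_count P (real t) v) = poly q (real t)"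
      using ehrhart_constituent[OF S D(1), of "D - 1" v] D(1) by (auto simp: n_def)
    have "p = q"
      using ehr_symmetric_constituents_eq[OF D(1) sym that ehr[OF that] p(2) q(2)] by blast
    have "real (dilate_count P (real 1) v) = poly p 1" using p(2)[of 1] by simp
    also have "\<dots> = (\<Sum>j<n. l j * real (dilate_count P (real (s j)) v))"
      using l[OF p(1)] q(2)[OF s_mod] \<open>p = q\<close> by simp
    finally show ?thesis
      by (simp add: sum.lessThan_Suc_shift t_def b_def sum_negf del: sum.lessThan_Suc)
  qed
  define C where "C j = (\<lambda>y. fst j + real (t (snd j)) *\<^sub>R y) ` P" for j
  obtain Z where Z: "finite Z" "Z \<subseteq> lattice_points"
    "\<And>z i v. \<lbrakk>z \<in> lattice_points; i \<in> {..<Suc n}; v \<in> ball w 1; v \<in> C (z, i)\<rbrakk> \<Longrightarrow> z \<in> Z"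
    "\<And>v. v \<in> ball w 1 \<Longrightarrow> (\<Sum>j\<in>{j\<in>Z \<times> {..<Suc n}. v \<in> C j}. b (snd j)) = 0"
    using indicator_relation_of_dilate_counts[OF V P sym, of "{..<Suc n}" "ball w 1" b t] rel
    by (auto simp: C_def)
  have "compact P" "convex P" using V by (auto simp: P compact_convex_hull finite_imp_compact)
  have "(\<Sum>j\<in>{j\<in>Z \<times> {..<Suc n}. w \<in> C j \<and> (\<forall>x\<in>C j. a \<bullet> x \<le> a \<bullet> w)}. b (snd j)) = 0"
  proof (rule euler_relation_top)
    show "compact (C j)" for j
      unfolding C_def using \<open>compact P\<close> by (intro compact_continuous_image continuous_intros)
    show "convex (C j)" for j
      unfolding C_def using \<open>convex P\<close> by (rule convex_affinity)
  qed (use Z in auto)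
  moreover have "{j\<in>Z \<times> {..<Suc n}. w \<in> C j \<and> (\<forall>x\<in>C j. a \<bullet> x \<le> a \<bullet> w)} = {(0, 0)}"
  proof (intro equalityI subsetI)
    fix j assume j: "j \<in> {j\<in>Z \<times> {..<Suc n}. w \<in> C j \<and> (\<forall>x\<in>C j. a \<bullet> x \<le> a \<bullet> w)}"
    obtain z i where ji: "j = (z, i)" by fastforce
    have "z \<in> lattice_points" using j ji Z(2) by auto
    obtain y where y: "y \<in> P" "w = z + real (t i) *\<^sub>R y" using j by (auto simp: ji C_def)
    have "z + real (t i) *\<^sub>R w \<in> C j" using w_in by (auto simp: ji C_def)
    then have "a \<bullet> (z + real (t i) *\<^sub>R w) \<le> a \<bullet> w" using j by blast
    also have "a \<bullet> w = a \<bullet> (z + real (t i) *\<^sub>R y)" using y by simp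
    finally have "a \<bullet> w \<le> a \<bullet> y" using t_pos[of i] by (simp add: inner_add_right)
    then have "y = w" using top[OF y(1)] by fastforce
    moreover have "z = w - real (t i) *\<^sub>R y" by (simp add: y(2))
    ultimately have z: "z = w - real (t i) *\<^sub>R w" by simp
    have "i = 0"
    proof (cases i)
      case (Suc k)
      \<comment> \<open>Here \<open>t i + 1\<close> is a multiple of \<open>D\<close>, so
        \<open>2w = z + (t i + 1) w\<close> is a lattice point.\<close>
      have "2 *\<^sub>R w = z + real (k + 2) *\<^sub>R (real D *\<^sub>R w)"
        using z by (simp add: t_def Suc s_real algebra_simps scaleR_2)
      also have "\<dots> \<in> lattice_points"
        using \<open>z \<in> lattice_points\<close> D(2)[OF w] by (intro lattice_points_add lattice_points_scale[OF _ D(2)[OF w]]) auto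
      finally show ?thesis using half by simp
    qed simp
    then show "j \<in> {(0, 0)}" using z by (simp add: ji t_def)
  next
    fix j :: "(real^'n) \<times> nat" assume "j \<in> {(0, 0)}"
    then have j: "j = (0, 0)" by simp
    have "C (0, 0) = P" by (simp add: C_def t_def)
    moreover have "a \<bullet> x \<le> a \<bullet> w" if "x \<in> P" for x using top[OF that] by fastforce
    moreover have "0 \<in> Z"
      using Z(3)[of 0 0 w] w_in \<open>C (0, 0) = P\<close> by (simp add: lattice_points_def)
    ultimately show "j \<in> {j\<in>Z \<times> {..<Suc n}. w \<in> C j \<and> (\<forall>x\<in>C j. a \<bullet> x \<le> a \<bullet> w)}"
      using w_in by (simp add: j)
  qed
  ultimately show False by (simp add: b_def)
qed

section \<open>Reduction to the vertices of 2P\<close>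

theorem theorem1p6:
  fixes P :: "(real^'n) set"
  assumes "rational_polytope P"
    and "aff_dim P = int CARD('n)"
    and "uminus ` P = P"
  shows "(\<forall>v. rational_vec v \<longrightarrow> ehr_symmetric ((\<lambda>x. x + v) ` P)) \<longleftrightarrow>
         (\<forall>x. x extreme_point_of ((\<lambda>y. 2 *\<^sub>R y) ` P) \<longrightarrow> x \<in> lattice_points)"
proof -
  obtain V where V: "finite V" "\<And>x. x \<in> V \<Longrightarrow> rational_vec x" and P: "P = convex hull V"
    using assms(1) unfolding rational_polytope_def by blast
  define V2 where "V2 = (\<lambda>y. 2 *\<^sub>R y) ` V"
  have P2: "(\<lambda>y. 2 *\<^sub>R y) ` P = convex hull V2"
    by (simp add: P V2_def convex_hull_scaling)
  have "finite V2" using V by (simp add: V2_def)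
  have "P \<noteq> {}" using assms(2) by auto
  show ?thesis
  proof (intro iffI allI impI)
    fix x assume ehr: "\<forall>v. rational_vec v \<longrightarrow> ehr_symmetric ((\<lambda>x. x + v) ` P)"
      and x: "x extreme_point_of ((\<lambda>y. 2 *\<^sub>R y) ` P)"
    have "x \<in> V2" using x unfolding P2 by (rule extreme_point_of_convex_hull)
    then obtain w where w: "w \<in> V" "x = 2 *\<^sub>R w" by (auto simp: V2_def)
    \<comment> \<open>Vertices of a polyhedron are exposed, which yields a functional
      \<open>a\<close> with a strict maximum at the vertex.\<close>
    have "{x} exposed_face_of ((\<lambda>y. 2 *\<^sub>R y) ` P)"
      using x polyhedron_convex_hull[OF \<open>finite V2\<close>] unfolding P2
      by (simp add: exposed_face_of_polyhedron face_of_singleton)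
    then obtain a c where a: "(\<lambda>y. 2 *\<^sub>R y) ` P \<subseteq> {y. a \<bullet> y \<le> c}"
      "{x} = (\<lambda>y. 2 *\<^sub>R y) ` P \<inter> {y. a \<bullet> y = c}"
      unfolding exposed_face_of_def by blast
    have "a \<bullet> y < a \<bullet> w" if "y \<in> P" "y \<noteq> w" for y
    proof -
      have "2 *\<^sub>R y \<in> (\<lambda>y. 2 *\<^sub>R y) ` P" "2 *\<^sub>R y \<noteq> x" using that w by auto
      then have "a \<bullet> (2 *\<^sub>R y) \<le> c" "a \<bullet> (2 *\<^sub>R y) \<noteq> c" "a \<bullet> x = c"
        using a by blast+
      then show ?thesis using w by simp
    qed
    then show "x \<in> lattice_points"
      unfolding w(2) using ehr
      by (intro ehr_symmetric_imp_vertex_half_integral[OF V P assms(3) _ w(1), of a]) auto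
  next
    fix v :: "real^'n" assume int: "\<forall>x. x extreme_point_of ((\<lambda>y. 2 *\<^sub>R y) ` P) \<longrightarrow> x \<in> lattice_points"
      and v: "rational_vec v"
    define S where "S = {x. x extreme_point_of ((\<lambda>y. 2 *\<^sub>R y) ` P)}"
    have hull: "convex hull S = (\<lambda>y. 2 *\<^sub>R y) ` P"
      unfolding S_def P2 using \<open>finite V2\<close>
      by (metis Krein_Milman_polytope)
    show "ehr_symmetric ((\<lambda>x. x + v) ` P)"
    proof (rule half_integral_imp_ehr_symmetric)
      have "S \<subseteq> V2" unfolding S_def P2 by (auto dest: extreme_point_of_convex_hull)
      then show "finite S" using \<open>finite V2\<close> by (rule finite_subset)
      show "S \<noteq> {}" using hull \<open>P \<noteq> {}\<close> by auto
      show "S \<subseteq> lattice_points" using int by (auto simp: S_def)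
    qed (use hull assms v in auto)
  qed
qed

end
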